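(* Let $d\in\mathbb N$, $T\in(0,\infty)$, $x_0\in\mathbb R^d$, $H_1,H_2\in(0,1)$ with $H_1\ne H_2$, $a_1,a_2\in\mathbb R\setminus\{0\}$, let $A\in\mathbb R^{d\times d}$ be invertible, and let $b:[0,T]\times\mathbb R^d\to\mathbb R^d$ be measurable and bounded. Let $X$ be a (weak) solution of $$X_t=x_0+\int_0^tb(s,X_s)\,\mathrm ds+A\big(a_1B_t^{H_1}+a_2B_t^{H_2}\big),\qquad t\in[0,T],$$ where $B^{H_1},B^{H_2}$ are completely correlated $d$-dimensional fractional Brownian motions. Then for all $t\in(0,T]$ the law of $X_t$ admits a density with respect to the Lebesgue measure on $\mathbb R^d$.
   Context: For $h\in(0,1)$ and $0<s<t$, the Volterra kernel of fractional Brownian motion with Hurst index $h$ is $K_h(t,s)=\Gamma(h+\tfrac12)^{-1}(t-s)^{h-1/2}F(h-\tfrac12,\tfrac12-h,h+\tfrac12,1-\tfrac ts)$, where $F$ is the Gauss hypergeometric function (for $h=1/2$, $K_h\equiv1$). Two $d$-dimensional fractional Brownian motions $B^{H_1},B^{H_2}$ are completely correlated if they are represented by the same $d$-dimensional Brownian motion $W$: $B^{H_i}_t=\int_0^tK_{H_i}(t,s)\,\mathrm dW_s$, $i=1,2$, $t\in[0,T]$. A weak solution of the SDE is a triple $(B^{H_1},B^{H_2},X)$ on a filtered probability space $(\Omega,(\mathcal A_t)_{t\in[0,T]},\mathbb P)$, with $X$ a continuous adapted $\mathbb R^d$-valued process, such that there is an $(\mathcal A_t)$-Brownian motion $W$ with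 $B^{H_i}_t=\int_0^tK_{H_i}(t,s)\,\mathrm dW_s$ for $i=1,2$, the SDE holds, and $\int_0^T|b(s,X_s)|\,\mathrm ds<\infty$ almost surely. *)

theory Defs
  imports "HOL-Probability.Probability" "HOL-Complex_Analysis.Complex_Analysis"
begin

(* Gauss hypergeometric function F(a,b,c,z): the power series on the unit disc, and its analytic
   continuation to the complex plane slit along [1,\<infinity>) elsewhere.  The continuation is unique by
   the identity theorem; it exists whenever c is not a nonpositive integer.  The values for |z| \<ge> 1
   are needed: the kernel below evaluates F at 1 - t/s, which ranges over (-\<infinity>,0). *)
definition gauss_hypergeo :: "complex \<Rightarrow> complex \<Rightarrow> complex \<Rightarrow> complex \<Rightarrow> complex" where
  "gauss_hypergeo a b c z =
    (if norm z < 1 then eval_fps (fps_hypergeo [a, b] [c] 1) z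
     else (THE w. \<exists>f. f holomorphic_on - (complex_of_real ` {1..}) \<and>
                 (\<forall>u\<in>ball 0 1. f u = eval_fps (fps_hypergeo [a, b] [c] 1) u) \<and> w = f z))"

(* Only used for 0 < s < t.  F is real there, so that Re is merely a type conversion. *)
definition fbm_kernel :: "real \<Rightarrow> real \<Rightarrow> real \<Rightarrow> real" where
  "fbm_kernel h t s =
     1 / Gamma (h + 1/2) * (t - s) powr (h - 1/2) *
     Re (gauss_hypergeo (of_real (h - 1/2)) (of_real (1/2 - h)) (of_real (h + 1/2)) (of_real (1 - t / s)))"

definition filtration_upto :: "'w measure \<Rightarrow> real \<Rightarrow> (real \<Rightarrow> 'w measure) \<Rightarrow> bool" where
  "filtration_upto M T \<A> \<longleftrightarrow>
     (\<forall>t\<in>{0..T}. subalgebra M (\<A> t)) \<and>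
     (\<forall>s\<in>{0..T}. \<forall>t\<in>{0..T}. s \<le> t \<longrightarrow> sets (\<A> s) \<subseteq> sets (\<A> t))"

definition adapted_upto :: "real \<Rightarrow> (real \<Rightarrow> 'w measure) \<Rightarrow> (real \<Rightarrow> 'w \<Rightarrow> 'b::topological_space) \<Rightarrow> bool" where
  "adapted_upto T \<A> Y \<longleftrightarrow> (\<forall>t\<in>{0..T}. Y t \<in> borel_measurable (\<A> t))"

(* Standard d-dimensional Brownian motion on [0,T] relative to the filtration \<A>. *)
definition brownian_motion ::
  "'w measure \<Rightarrow> real \<Rightarrow> (real \<Rightarrow> 'w measure) \<Rightarrow> (real \<Rightarrow> 'w \<Rightarrow> real ^ 'd) \<Rightarrow> bool" where
  "brownian_motion M T \<A> W \<longleftrightarrow>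
     adapted_upto T \<A> W \<and>
     (AE \<omega> in M. W 0 \<omega> = 0) \<and>
     (AE \<omega> in M. continuous_on {0..T} (\<lambda>t. W t \<omega>)) \<and>
     (\<forall>s t. 0 \<le> s \<and> s < t \<and> t \<le> T \<longrightarrow>
        prob_space.indep_set M (sets (\<A> s))
          {(\<lambda>\<omega>. W t \<omega> - W s \<omega>) -` S \<inter> space M | S. S \<in> sets borel} \<and>
        distributed M lborel (\<lambda>\<omega>. W t \<omega> - W s \<omega>)
          (\<lambda>x. ennreal (\<Prod>i\<in>UNIV. normal_density 0 (sqrt (t - s)) (x $ i))))"

definition step_fun :: "nat \<Rightarrow> (nat \<Rightarrow> real) \<Rightarrow> (nat \<Rightarrow> real) \<Rightarrow> real \<Rightarrow> real" where
  "step_fun n p c s = (\<Sum>i<n. c i * indicator {p i<..p (Suc i)} s)"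

definition step_integral ::
  "(real \<Rightarrow> 'w \<Rightarrow> 'b::real_vector) \<Rightarrow> nat \<Rightarrow> (nat \<Rightarrow> real) \<Rightarrow> (nat \<Rightarrow> real) \<Rightarrow> 'w \<Rightarrow> 'b" where
  "step_integral W n p c \<omega> = (\<Sum>i<n. c i *\<^sub>R (W (p (Suc i)) \<omega> - W (p i) \<omega>))"

(* Y is (a version of) the Wiener integral of the deterministic real function f over (0,t) against
   W: f is approximated in L^2(0,t) by step functions whose elementary integrals converge to Y in
   L^2 of the probability space.  By the Ito isometry, Y is unique up to null sets and does not
   depend on the approximating step functions; such Y exists iff f is in L^2(0,t). *)
definition has_wiener_integral ::
  "'w measure \<Rightarrow> (real \<Rightarrow> 'w \<Rightarrow> real ^ 'd) \<Rightarrow> real \<Rightarrow> (real \<Rightarrow> real) \<Rightarrow> ('w \<Rightarrow> real ^ 'd) \<Rightarrow> bool" where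
  "has_wiener_integral M W t f Y \<longleftrightarrow>
     Y \<in> borel_measurable M \<and>
     set_borel_measurable borel {0<..<t} f \<and>
     (\<exists>(n::nat \<Rightarrow> nat) (p::nat \<Rightarrow> nat \<Rightarrow> real) (c::nat \<Rightarrow> nat \<Rightarrow> real).
        (\<forall>k. mono_on {..n k} (p k) \<and> p k ` {..n k} \<subseteq> {0..t}) \<and>
        (\<lambda>k. \<integral>\<^sup>+s\<in>{0<..<t}. ennreal ((f s - step_fun (n k) (p k) (c k) s)\<^sup>2) \<partial>lborel) \<longlonglongrightarrow> 0 \<and>
        (\<lambda>k. \<integral>\<^sup>+\<omega>. ennreal ((norm (Y \<omega> - step_integral W (n k) (p k) (c k) \<omega>))\<^sup>2) \<partial>M) \<longlonglongrightarrow> 0)"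

(* B is the fractional Brownian motion with Hurst index h driven by W.  Two fractional Brownian
   motions are completely correlated if they are driven by the same W. *)
definition fbm_driven_by ::
  "'w measure \<Rightarrow> real \<Rightarrow> (real \<Rightarrow> 'w \<Rightarrow> real ^ 'd) \<Rightarrow> real \<Rightarrow> (real \<Rightarrow> 'w \<Rightarrow> real ^ 'd) \<Rightarrow> bool" where
  "fbm_driven_by M T W h B \<longleftrightarrow> (\<forall>t\<in>{0..T}. has_wiener_integral M W t (fbm_kernel h t) (B t))"

definition weak_solution ::
  "'w measure \<Rightarrow> (real \<Rightarrow> 'w measure) \<Rightarrow> real \<Rightarrow> real ^ 'd \<Rightarrow> (real \<Rightarrow> real ^ 'd \<Rightarrow> real ^ 'd) \<Rightarrow>
   real ^ 'd ^ 'd \<Rightarrow> real \<Rightarrow> real \<Rightarrow> real \<Rightarrow> real \<Rightarrow>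
   (real \<Rightarrow> 'w \<Rightarrow> real ^ 'd) \<Rightarrow> (real \<Rightarrow> 'w \<Rightarrow> real ^ 'd) \<Rightarrow> (real \<Rightarrow> 'w \<Rightarrow> real ^ 'd) \<Rightarrow> bool" where
  "weak_solution M \<A> T x0 b A a1 a2 H1 H2 B1 B2 X \<longleftrightarrow>
     prob_space M \<and> filtration_upto M T \<A> \<and>
     adapted_upto T \<A> X \<and>
     (AE \<omega> in M. continuous_on {0..T} (\<lambda>t. X t \<omega>)) \<and>
     (\<exists>W. brownian_motion M T \<A> W \<and> fbm_driven_by M T W H1 B1 \<and> fbm_driven_by M T W H2 B2) \<and>
     (AE \<omega> in M. set_integrable lborel {0..T} (\<lambda>s. b s (X s \<omega>))) \<and>
     (AE \<omega> in M. \<forall>t\<in>{0..T}.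
        X t \<omega> = x0 + (LINT s:{0..t}|lborel. b s (X s \<omega>)) + A *v (a1 *\<^sub>R B1 t \<omega> + a2 *\<^sub>R B2 t \<omega>))"

end

theory Submission
  imports Defs
begin

text \<open>Freeze the solution at time \<^term>\<open>t - \<epsilon>\<close>. Up to an error of order \<^term>\<open>\<epsilon>\<close> caused by the bounded drift,
  the solution at time \<^term>\<open>t\<close> is, after an invertible linear map, a variable known at time \<^term>\<open>t - \<epsilon>\<close> plus an independent
  Gaussian vector. Its standard deviation is at least of order \<^term>\<open>\<epsilon> powr H\<close>, where \<^term>\<open>H\<close> is the
  smaller Hurst index, because near the diagonal the kernel with the smaller index dominates. Hence
  for Gaussian averages of a test function at the scales \<^term>\<open>\<delta>\<close> and \<^term>\<open>\<delta> / 2\<close>, the expectations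
  along the solution differ by at most a multiple of \<^term>\<open>\<epsilon> / \<delta> + \<delta> / \<epsilon> powr H\<close>. Choosing
  \<^term>\<open>\<epsilon> = \<delta> powr a\<close> with \<^term>\<open>1 < a \<and> a < 1 / H\<close>, which is possible since \<^term>\<open>H < 1\<close>, makes these
  differences summable over dyadic \<^term>\<open>\<delta>\<close>, uniformly in the test function, and this forces the law to be absolutely
  continuous. Neither Girsanov's theorem nor an inversion of the Volterra kernel is needed.\<close>
section \<open>Gaussian smoothing\<close>

text \<open>Two estimates compete. A Gaussian average at scale \<open>\<delta>\<close> of a test
  function with values in the unit interval has Lipschitz constant of order
  \<open>1 / \<delta>\<close>, so an error of size \<open>\<epsilon>\<close> in the solution costs
  \<open>\<epsilon> / \<delta>\<close>. An independent Gaussian summand with deviation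
  \<open>\<sigma>\<close> acts on expectations as a further Gaussian average. Averages at different
  scales commute, and one at scale \<open>\<delta>\<close> moves a function with Lipschitz constant
  of order \<open>1 / \<sigma>\<close> by at most a multiple of \<open>\<delta> / \<sigma>\<close>.
  The linear map is the inverse of \<open>A\<close>: it makes the covariance of the innovation a
  multiple of the identity, so that one scale describes it. The obstacle is that a Volterra kernel
  depends on its upper limit, so the noise increment over a short interval is not independent of the
  past. Its past part is never estimated but merged into the variable known at the earlier time,
  where its size does not matter. Only the innovation has to be controlled, and only its variance
  from below.\<close>

definition gauss_density :: "real \<Rightarrow> 'a::euclidean_space \<Rightarrow> real" where
  "gauss_density s x = (\<Prod>b\<in>Basis. normal_density 0 s (x \<bullet> b))"

text \<open>At \<open>s = 0\<close> the formula for \<open>gauss_density\<close> vanishes because of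
  division by zero, so the Dirac mass is put in by hand. The semigroup law then also covers steps
  with coefficient 0 and empty sums of increments.\<close>

definition gauss :: "real \<Rightarrow> 'a::euclidean_space measure" where
  "gauss s = (if s = 0 then return borel 0 else density lborel (\<lambda>x. ennreal (gauss_density s x)))"

text \<open>This is the heat semigroup, parametrised by standard deviation instead of time.\<close>

definition smooth :: "real \<Rightarrow> ('a::euclidean_space \<Rightarrow> real) \<Rightarrow> 'a \<Rightarrow> real" where
  "smooth s \<phi> x = (LINT z|gauss s. \<phi> (x + z))"

text \<open>The class contains the indicators of open sets and is stable under
  \<open>smooth\<close>. The common bound 1 is what makes all later constants uniform in the test
  function.\<close>

definition unit_valued :: "('a::euclidean_space \<Rightarrow> real) \<Rightarrow> bool" where
  "unit_valued \<phi> \<longleftrightarrow> \<phi> \<in> borel_measurable borel \<and> (\<forall>x. 0 \<le> \<phi> x \<and> \<phi> x \<le> 1)"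

lemma unit_valuedI:
  "\<phi> \<in> borel_measurable borel \<Longrightarrow> (\<And>x. 0 \<le> \<phi> x) \<Longrightarrow> (\<And>x. \<phi> x \<le> 1) \<Longrightarrow> unit_valued \<phi>"
  by (simp add: unit_valued_def)

lemma unit_valuedD:
  assumes "unit_valued \<phi>"
  shows "\<phi> \<in> borel_measurable borel" "0 \<le> \<phi> x" "\<phi> x \<le> 1"
  using assms by (auto simp: unit_valued_def)

lemma gauss_density_nonneg [simp]: "0 \<le> gauss_density s x"
  unfolding gauss_density_def by (intro prod_nonneg) simp

lemma gauss_density_measurable [measurable]: "gauss_density s \<in> borel_measurable borel"
  unfolding gauss_density_def[abs_def] by measurable

lemma ennreal_gauss_density:
  "ennreal (gauss_density s x) = (\<Prod>b\<in>Basis. ennreal (normal_density 0 s (x \<bullet> b)))"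
  unfolding gauss_density_def by (subst prod_ennreal) auto

lemma nn_integral_normal_density: "0 < s \<Longrightarrow> (\<integral>\<^sup>+x. ennreal (normal_density \<mu> s x) \<partial>lborel) = 1"
  by (subst nn_integral_eq_integral) auto

lemma nn_integral_gauss_density:
  assumes "0 < s"
  shows "(\<integral>\<^sup>+x. ennreal (gauss_density s x) \<partial>(lborel :: 'a::euclidean_space measure)) = 1"
  unfolding ennreal_gauss_density
  using assms by (subst nn_integral_lborel_prod) (auto simp: nn_integral_normal_density)

lemma sets_gauss [simp, measurable_cong]: "sets (gauss s) = sets borel"
  by (simp add: gauss_def)

lemma space_gauss [simp]: "space (gauss s) = UNIV"
  by (simp add: gauss_def)

lemma prob_space_gauss:
  assumes "0 \<le> s" shows "prob_space (gauss s :: 'a::euclidean_space measure)"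
proof (cases "s = 0")
  case True
  then show ?thesis by (auto simp: gauss_def intro!: prob_space_return)
next
  case False
  with assms have "0 < s" by simp
  show ?thesis
    by (rule prob_spaceI)
       (use False nn_integral_gauss_density[OF \<open>0 < s\<close>, where 'a='a] in
         \<open>simp add: gauss_def emeasure_density\<close>)
qed

lemma gauss_density_eq:
  assumes "0 < s"
  shows "gauss_density s (x::'a::euclidean_space)
    = (1 / sqrt (2 * pi * s\<^sup>2)) ^ DIM('a) * exp (- (norm x)\<^sup>2 / (2 * s\<^sup>2))"
proof -
  have "gauss_density s x
    = (\<Prod>b\<in>(Basis::'a set). 1 / sqrt (2 * pi * s\<^sup>2)) * (\<Prod>b\<in>Basis. exp (- (x \<bullet> b)\<^sup>2 / (2 * s\<^sup>2)))"
    unfolding gauss_density_def normal_density_def by (subst prod.distrib[symmetric]) simp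
  also have "(\<Prod>b\<in>Basis. exp (- (x \<bullet> b)\<^sup>2 / (2 * s\<^sup>2))) = exp (\<Sum>b\<in>Basis. - (x \<bullet> b)\<^sup>2 / (2 * s\<^sup>2))"
    by (simp add: exp_sum)
  also have "(\<Sum>b\<in>Basis. - (x \<bullet> b)\<^sup>2 / (2 * s\<^sup>2)) = - (\<Sum>b\<in>Basis. (x \<bullet> b)\<^sup>2) / (2 * s\<^sup>2)"
    by (simp add: sum_divide_distrib sum_negf)
  also have "(\<Sum>b\<in>Basis. (x \<bullet> b)\<^sup>2) = (norm x)\<^sup>2"
    by (subst power2_norm_eq_inner, subst (2) euclidean_inner) (simp add: power2_eq_square)
  finally show ?thesis
    by simp
qed

lemma gauss_density_le:
  assumes "0 < s"
  shows "gauss_density s (x::'a::euclidean_space) \<le> (1 / sqrt (2 * pi * s\<^sup>2)) ^ DIM('a)"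
  unfolding gauss_density_eq[OF assms]
  by (intro mult_left_le) (auto)

lemma integrable_gauss_density:
  assumes "0 < s" shows "integrable lborel (gauss_density s :: 'a::euclidean_space \<Rightarrow> real)"
  using nn_integral_gauss_density[OF assms, where 'a='a]
  by (intro integrableI_nonneg) auto

lemma integral_gauss_density:
  assumes "0 < s" shows "(LINT x|lborel. gauss_density s (x :: 'a::euclidean_space)) = 1"
  using nn_integral_gauss_density[OF assms, where 'a='a]
  by (simp add: integral_eq_nn_integral)

text \<open>The exact value is \<open>s * sqrt (2 / pi)\<close>; the root is at most 1 because pi is
  at least 2.\<close>

lemma nn_integral_normal_density_abs:
  assumes "0 < s" shows "(\<integral>\<^sup>+x. ennreal (normal_density 0 s x * \<bar>x\<bar>) \<partial>lborel) \<le> ennreal s"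
proof -
  have *: "has_bochner_integral lborel (\<lambda>x. normal_density 0 s x * \<bar>x - 0\<bar> ^ (2 * 0 + 1))
     (2 ^ 0 * s ^ (2 * 0 + 1) * fact 0 * sqrt (2 / pi))"
    using normal_moment_abs_odd[OF assms, of 0 0] by simp
  have "(\<integral>\<^sup>+x. ennreal (normal_density 0 s x * \<bar>x\<bar>) \<partial>lborel) = ennreal (s * sqrt (2 / pi))"
    using * by (subst nn_integral_eq_integral) (auto simp: has_bochner_integral_iff)
  also have "\<dots> \<le> ennreal s"
    using assms pi_ge_two by (intro ennreal_leI mult_left_le) (auto)
  finally show ?thesis .
qed

lemma nn_integral_norm_gauss:
  assumes "0 < s"
  shows "(\<integral>\<^sup>+x. ennreal (norm x * gauss_density s x) \<partial>(lborel :: 'a::euclidean_space measure))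
    \<le> ennreal (real DIM('a) * s)"
proof -
  have 1: "(\<integral>\<^sup>+x. ennreal (\<bar>x \<bullet> b\<bar> * gauss_density s x) \<partial>(lborel :: 'a measure)) \<le> ennreal s"
    if b: "b \<in> Basis" for b :: 'a
  proof -
    \<comment> \<open>The factor belonging to coordinate \<open>b\<close> is absorbed into the
      \<open>b\<close>-th density, so the integrand is again a product over coordinates and the
      integral factorises.\<close>
    define f where "f c y = (if c = b then ennreal (normal_density 0 s y * \<bar>y\<bar>)
      else ennreal (normal_density 0 s y))" for c :: 'a and y :: real
    have [measurable]: "f c \<in> borel_measurable borel" for c
      unfolding f_def by measurable
    have "ennreal (\<bar>x \<bullet> b\<bar> * gauss_density s x) = (\<Prod>c\<in>Basis. f c (x \<bullet> c))" for x
      unfolding gauss_density_def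
      by (subst (1 2) prod.remove[OF finite_Basis b])
         (simp add: f_def ennreal_mult' prod_nonneg prod_ennreal mult_ac)
    then have "(\<integral>\<^sup>+x. ennreal (\<bar>x \<bullet> b\<bar> * gauss_density s x) \<partial>(lborel :: 'a measure))
      = (\<Prod>c\<in>Basis. \<integral>\<^sup>+y. f c y \<partial>lborel)"
      by (simp add: nn_integral_lborel_prod)
    also have "\<dots> = (\<integral>\<^sup>+y. f b y \<partial>lborel)"
    proof -
      have "(\<integral>\<^sup>+y. f c y \<partial>lborel) = 1" if "c \<noteq> b" for c
        using that by (simp add: f_def nn_integral_normal_density[OF assms])
      then show ?thesis
        by (subst prod.remove[OF finite_Basis b]) simp
    qed
    also have "\<dots> \<le> ennreal s"
      using nn_integral_normal_density_abs[OF assms] by (simp add: f_def)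
    finally show ?thesis .
  qed
  have "(\<integral>\<^sup>+x. ennreal (norm x * gauss_density s x) \<partial>(lborel :: 'a measure))
    \<le> (\<integral>\<^sup>+x. (\<Sum>b\<in>Basis. ennreal (\<bar>x \<bullet> b\<bar> * gauss_density s x)) \<partial>(lborel :: 'a measure))"
    by (intro nn_integral_mono)
       (auto simp: sum_ennreal sum_distrib_right[symmetric] intro!: ennreal_leI mult_right_mono norm_le_l1)
  also have "\<dots> = (\<Sum>b\<in>Basis. \<integral>\<^sup>+x. ennreal (\<bar>x \<bullet> b\<bar> * gauss_density s x) \<partial>(lborel :: 'a measure))"
    by (rule nn_integral_sum) auto
  also have "\<dots> \<le> (\<Sum>b\<in>(Basis::'a set). ennreal s)"
    by (intro sum_mono 1)
  also have "\<dots> = ennreal (real DIM('a) * s)"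
    using assms by (simp add: ennreal_mult ennreal_of_nat_eq_real_of_nat)
  finally show ?thesis .
qed

lemma
  assumes "0 < s"
  shows integrable_norm_gauss_density:
      "integrable lborel (\<lambda>x::'a::euclidean_space. norm x * gauss_density s x)"
    and integral_norm_gauss_density_le:
      "(LINT x|lborel. norm (x::'a) * gauss_density s x) \<le> real DIM('a) * s"
proof -
  have *: "(\<integral>\<^sup>+x. ennreal (norm x * gauss_density s x) \<partial>(lborel :: 'a measure)) < \<infinity>"
    by (rule le_less_trans[OF nn_integral_norm_gauss[OF assms]]) simp
  show "integrable lborel (\<lambda>x::'a. norm x * gauss_density s x)"
    using * by (intro integrableI_nonneg) auto
  show "(LINT x|lborel. norm (x::'a) * gauss_density s x) \<le> real DIM('a) * s"
    using nn_integral_norm_gauss[OF assms, where 'a='a] assms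
    by (subst integral_eq_nn_integral) (auto intro!: enn2real_leI)
qed

lemma integral_gauss_norm_le:
  assumes "0 \<le> s"
  shows "integrable (gauss s) (norm :: 'a::euclidean_space \<Rightarrow> real)"
    and "(LINT z|gauss s. norm (z::'a)) \<le> real DIM('a) * s"
proof -
  have 0: "(\<integral>\<^sup>+z. ennreal (norm (norm (z::'a))) \<partial>return borel 0) = 0"
    by (subst nn_integral_return) auto
  show "integrable (gauss s) (norm :: 'a \<Rightarrow> real)"
    using assms integrable_norm_gauss_density[of s, where 'a='a] 0
    by (cases "s = 0") (auto simp: gauss_def integrable_density mult.commute intro!: integrableI_bounded)
  show "(LINT z|gauss s. norm (z::'a)) \<le> real DIM('a) * s"
    using assms integral_norm_gauss_density_le[of s, where 'a='a]
    by (cases "s = 0") (auto simp: gauss_def integral_density integral_return mult.commute)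
qed

section \<open>Lipschitz bound for Gaussian averages\<close>

lemma abs_exp_minus_diff_le: "\<bar>exp (- a) - exp (- b)\<bar> \<le> \<bar>a - b\<bar> * (exp (- a) + exp (- b :: real))"
proof -
  have *: "\<bar>exp (- a) - exp (- b)\<bar> \<le> \<bar>a - b\<bar> * (exp (- a) + exp (- b))" if "a \<le> b" for a b :: real
  proof -
    have "exp (- a) - exp (- b) = exp (- a) * (1 - exp (- (b - a)))"
      by (simp add: algebra_simps flip: exp_add)
    also have "\<dots> \<le> exp (- a) * (b - a)"
      using exp_ge_add_one_self[of "a - b"] by (intro mult_left_mono) (auto simp: algebra_simps)
    also have "\<dots> \<le> (exp (- a) + exp (- b)) * (b - a)"
      using that by (intro mult_right_mono) auto
    finally show ?thesis using that by (simp add: mult.commute)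
  qed
  show ?thesis
    using *[of a b] *[of b a] by (cases "a \<le> b") (auto simp: abs_minus_commute add.commute)
qed

text \<open>The mixed factor \<open>norm (z - h) + norm z\<close> is split by the triangle
  inequality so that each summand on the right involves a single argument, \<open>z - h\<close> or
  \<open>z\<close>. Translation invariance then gives both summands the same integral.\<close>

lemma gauss_density_shift:
  assumes s: "0 < s"
  shows "\<bar>gauss_density s (z - h) - gauss_density s z\<bar> \<le>
    norm h / (2 * s\<^sup>2) * ((2 * norm (z - h) + norm h) * gauss_density s (z - h)
      + (2 * norm z + norm h) * gauss_density s (z::'a::euclidean_space))"
proof -
  define c where "c = (1 / sqrt (2 * pi * s\<^sup>2)) ^ DIM('a)"
  have c: "0 \<le> c" by (simp add: c_def)
  define u where "u = (norm (z - h))\<^sup>2 / (2 * s\<^sup>2)"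
  define v where "v = (norm z)\<^sup>2 / (2 * s\<^sup>2)"
  have g: "gauss_density s (z - h) = c * exp (- u)" "gauss_density s z = c * exp (- v)"
    by (simp_all add: gauss_density_eq[OF s] c_def u_def v_def)
  have tri: "\<bar>norm (z - h) - norm z\<bar> \<le> norm h"
    by (metis norm_triangle_ineq3 norm_minus_commute diff_diff_eq2 add_diff_cancel_left')
  have "\<bar>u - v\<bar> = \<bar>norm (z - h) - norm z\<bar> * (norm (z - h) + norm z) / (2 * s\<^sup>2)"
    unfolding u_def v_def by (simp add: diff_divide_distrib[symmetric] power2_eq_square
      square_diff_square_factored abs_mult mult.commute)
  also have "\<dots> \<le> norm h * (norm (z - h) + norm z) / (2 * s\<^sup>2)"
    using tri by (intro divide_right_mono mult_right_mono) auto
  finally have uv: "\<bar>u - v\<bar> \<le> norm h / (2 * s\<^sup>2) * (norm (z - h) + norm z)" by simp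
  have "\<bar>gauss_density s (z - h) - gauss_density s z\<bar> = c * \<bar>exp (- u) - exp (- v)\<bar>"
    unfolding g using c by (simp add: abs_mult flip: right_diff_distrib)
  also have "\<dots> \<le> c * (\<bar>u - v\<bar> * (exp (- u) + exp (- v)))"
    using c by (intro mult_left_mono abs_exp_minus_diff_le)
  also have "\<dots> \<le> c * ((norm h / (2 * s\<^sup>2) * (norm (z - h) + norm z)) * (exp (- u) + exp (- v)))"
    using c uv by (intro mult_left_mono mult_right_mono) auto
  also have "\<dots> = norm h / (2 * s\<^sup>2) * ((norm (z - h) + norm z) * gauss_density s (z - h)
      + (norm (z - h) + norm z) * gauss_density s z)"
    unfolding g by algebra
  also have "\<dots> \<le> norm h / (2 * s\<^sup>2) * ((2 * norm (z - h) + norm h) * gauss_density s (z - h)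
      + (2 * norm z + norm h) * gauss_density s z)"
  proof -
    have "norm (z - h) + norm z \<le> 2 * norm (z - h) + norm h" "norm (z - h) + norm z \<le> 2 * norm z + norm h"
      using tri by auto
    then show ?thesis
      by (intro mult_left_mono add_mono[OF mult_right_mono mult_right_mono]) auto
  qed
  finally show ?thesis .
qed

lemma integral_lborel_translate:
  fixes f :: "'a::euclidean_space \<Rightarrow> real"
  assumes [measurable]: "f \<in> borel_measurable borel"
  shows "(LINT z|lborel. f (c + z)) = (LINT z|lborel. f z)"
    and "integrable lborel (\<lambda>z. f (c + z)) \<longleftrightarrow> integrable lborel f"
proof -
  have *: "distr lborel borel (\<lambda>z. c + z) = lborel"
    using lborel_distr_plus[of c] by simp
  show "(LINT z|lborel. f (c + z)) = (LINT z|lborel. f z)"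
    by (subst (2) *[symmetric], subst integral_distr) auto
  show "integrable lborel (\<lambda>z. f (c + z)) \<longleftrightarrow> integrable lborel f"
    by (subst (2) *[symmetric], subst integrable_distr_eq) auto
qed

lemma integrable_unit_valued:
  assumes "finite_measure N" "unit_valued \<phi>" "f \<in> borel_measurable N"
  shows "integrable N (\<lambda>x. \<phi> (f x))"
proof -
  interpret finite_measure N by fact
  note [measurable] = unit_valuedD(1)[OF assms(2)] assms(3)
  show ?thesis
    by (rule integrable_const_bound[where B=1]) (simp_all add: unit_valuedD[OF assms(2)])
qed

lemma integral_unit_valued:
  assumes "prob_space N" "unit_valued \<phi>" "f \<in> borel_measurable N"
  shows "0 \<le> (LINT x|N. \<phi> (f x))" "(LINT x|N. \<phi> (f x)) \<le> 1"
proof -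
  interpret prob_space N by fact
  have i: "integrable N (\<lambda>x. \<phi> (f x))"
    by (rule integrable_unit_valued[OF finite_measure_axioms assms(2,3)])
  have "(LINT x|N. \<phi> (f x)) \<le> (LINT x|N. 1)"
    using i by (rule integral_mono) (simp_all add: unit_valuedD[OF assms(2)])
  then show "(LINT x|N. \<phi> (f x)) \<le> 1" by (simp add: prob_space)
  show "0 \<le> (LINT x|N. \<phi> (f x))"
    by (rule Bochner_Integration.integral_nonneg) (simp add: unit_valuedD[OF assms(2)])
qed

lemma smooth_unit_valued:
  assumes "0 \<le> s" "unit_valued \<phi>" shows "unit_valued (smooth s \<phi>)"
proof (rule unit_valuedI)
  interpret prob_space "gauss s :: 'a measure" by (rule prob_space_gauss) fact
  note [measurable] = unit_valuedD(1)[OF assms(2)]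
  show "smooth s \<phi> \<in> borel_measurable borel"
    unfolding smooth_def[abs_def] by measurable
  show "0 \<le> smooth s \<phi> x" "smooth s \<phi> x \<le> 1" for x
    unfolding smooth_def by (rule integral_unit_valued[OF prob_space_axioms assms(2)], simp)+
qed

text \<open>Moves the shift from the test function, which is merely measurable, to the smooth
  density, where differences in \<open>x\<close> can be estimated.\<close>

lemma smooth_lborel:
  assumes "0 < s" "unit_valued \<phi>"
  shows "smooth s \<phi> x = (LINT z|lborel. \<phi> z * gauss_density s (z - x))"
    and "integrable lborel (\<lambda>z. \<phi> z * gauss_density s (z - x))"
proof -
  note [measurable] = unit_valuedD(1)[OF assms(2)]
  have "smooth s \<phi> x = (LINT z|lborel. \<phi> (x + z) * gauss_density s z)"
    using assms(1) by (simp add: smooth_def gauss_def integral_density mult.commute)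
  also have "\<dots> = (LINT z|lborel. \<phi> z * gauss_density s (z - x))"
    using integral_lborel_translate(1)[of "\<lambda>z. \<phi> z * gauss_density s (z - x)" x] by simp
  finally show "smooth s \<phi> x = (LINT z|lborel. \<phi> z * gauss_density s (z - x))" .
  have "integrable lborel (\<lambda>z. gauss_density s (z - x))"
    using integral_lborel_translate(2)[of "gauss_density s" "- x"] integrable_gauss_density[OF assms(1), where 'a='a]
    by simp
  then show "integrable lborel (\<lambda>z. \<phi> z * gauss_density s (z - x))"
    by (rule Bochner_Integration.integrable_bound)
       (auto simp: abs_mult unit_valuedD[OF assms(2)] intro!: mult_left_le_one_le)
qed

lemma smooth_0 [simp]: "\<phi> \<in> borel_measurable borel \<Longrightarrow> smooth 0 \<phi> = \<phi>"
  by (rule ext) (simp add: smooth_def gauss_def integral_return)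

lemma smooth_Lipschitz:
  fixes \<phi> :: "'a::euclidean_space \<Rightarrow> real"
  assumes s: "0 < s" and \<phi>: "unit_valued \<phi>"
  shows "\<bar>smooth s \<phi> x - smooth s \<phi> y\<bar> \<le> (2 * real DIM('a) + 1) / s * norm (x - y)"
\<comment> \<open>Beyond distance \<open>s\<close> the right-hand side is at least 1, which bounds
  any difference of averages. Within distance \<open>s\<close> the term \<open>norm h\<close> in
  \<open>gauss_density_shift\<close> is at most \<open>s\<close> and merges with the first moment
  \<open>real DIM('a) * s\<close>, which yields \<open>2 * real DIM('a) + 1\<close>.\<close>
proof (cases "norm (x - y) \<le> s")
  case False
  have "unit_valued (smooth s \<phi>)"
    using smooth_unit_valued[OF _ \<phi>] s by simp
  from unit_valuedD[OF this] have "\<bar>smooth s \<phi> x - smooth s \<phi> y\<bar> \<le> 1"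
    by (simp add: abs_le_iff add_increasing2 diff_le_eq)
  also have "1 \<le> (2 * real DIM('a) + 1) / s * norm (x - y)"
  proof -
    have "1 \<le> norm (x - y) / s" using False s by simp
    also have "\<dots> \<le> (2 * real DIM('a) + 1) * (norm (x - y) / s)"
      using s mult_right_mono[of 1 "2 * real DIM('a) + 1" "norm (x - y) / s"] by simp
    finally show ?thesis by simp
  qed
  finally show ?thesis .
next
  case True
  define h where "h = x - y"
  note [measurable] = unit_valuedD(1)[OF \<phi>]
  have tr: "(LINT z|lborel. f (z - c)) = (LINT z|lborel. f z)"
           "integrable lborel (\<lambda>z. f (z - c)) \<longleftrightarrow> integrable lborel f"
    if "f \<in> borel_measurable borel" for f :: "'a \<Rightarrow> real" and c
    using integral_lborel_translate[OF that, of "- c"] by auto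
  define G where "G z = (2 * norm z + norm h) * gauss_density s z" for z :: 'a
  have [measurable]: "G \<in> borel_measurable borel" unfolding G_def[abs_def] by measurable
  have G: "integrable lborel G" "(LINT z|lborel. G z) \<le> 2 * (real DIM('a) * s) + norm h"
  proof -
    have G_eq: "G = (\<lambda>z. 2 * (norm z * gauss_density s z) + norm h * gauss_density s z)"
      by (auto simp: G_def algebra_simps)
    show "integrable lborel G" unfolding G_eq
      using integrable_norm_gauss_density[OF s, where 'a='a] integrable_gauss_density[OF s, where 'a='a] by auto
    show "(LINT z|lborel. G z) \<le> 2 * (real DIM('a) * s) + norm h" unfolding G_eq
      using integrable_norm_gauss_density[OF s, where 'a='a] integrable_gauss_density[OF s, where 'a='a]
        integral_norm_gauss_density_le[OF s, where 'a='a]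
      by (simp add: integral_gauss_density[OF s])
  qed
  define D where "D z = norm h / (2 * s\<^sup>2) * (G (z - x) + G (z - y))" for z
  have iG: "integrable lborel (\<lambda>z. G (z - c))" "(LINT z|lborel. G (z - c)) = (LINT z|lborel. G z)" for c
    using tr[of G c] G(1) by auto
  have iD: "integrable lborel D" unfolding D_def[abs_def] using iG by auto
  have D: "\<bar>gauss_density s (z - x) - gauss_density s (z - y)\<bar> \<le> D z" for z
    using gauss_density_shift[OF s, of "z - y" h]
    by (simp add: h_def D_def G_def algebra_simps)
  have "smooth s \<phi> x - smooth s \<phi> y
    = (LINT z|lborel. \<phi> z * gauss_density s (z - x) - \<phi> z * gauss_density s (z - y))"
    using smooth_lborel[OF s \<phi>] by simp
  also have "\<bar>\<dots>\<bar> \<le> (LINT z|lborel. D z)"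
  proof (rule order_trans[OF integral_abs_bound], rule integral_mono)
    fix z
    show "\<bar>\<phi> z * gauss_density s (z - x) - \<phi> z * gauss_density s (z - y)\<bar> \<le> D z"
      using D[of z] unit_valuedD(2,3)[OF \<phi>, of z] mult_left_le_one_le[of "\<bar>gauss_density s (z - x) - gauss_density s (z - y)\<bar>" "\<phi> z"]
      by (simp add: abs_mult flip: right_diff_distrib)
  qed (use iD smooth_lborel[OF s \<phi>] in auto)
  also have "\<dots> = norm h / (2 * s\<^sup>2) * (2 * (LINT z|lborel. G z))"
    unfolding D_def using iG by simp
  also have "\<dots> \<le> norm h / (2 * s\<^sup>2) * (2 * (2 * (real DIM('a) * s) + s))"
    using G True by (intro mult_left_mono) (auto simp: h_def)
  also have "\<dots> = (2 * real DIM('a) + 1) / s * norm (x - y)"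
    using s by (simp add: h_def power2_eq_square field_simps)
  finally show ?thesis .
qed

section \<open>The convolution semigroup of Gaussian measures\<close>

lemma convolution_gauss:
  assumes "0 \<le> s" "0 \<le> t"
  shows "distr (gauss s \<Otimes>\<^sub>M gauss t) borel (\<lambda>(x, y). x + y)
    = (gauss (sqrt (s\<^sup>2 + t\<^sup>2)) :: 'a::euclidean_space measure)"
proof -
  interpret S: prob_space "gauss s :: 'a measure" by (rule prob_space_gauss) fact
  interpret T: prob_space "gauss t :: 'a measure" by (rule prob_space_gauss) fact
  interpret pair_prob_space "gauss s :: 'a measure" "gauss t :: 'a measure" ..
  have lhs: "emeasure (distr (gauss s \<Otimes>\<^sub>M gauss t) borel (\<lambda>(x, y). x + y)) A
    = (\<integral>\<^sup>+y. \<integral>\<^sup>+x. indicator A (x + y) \<partial>gauss s \<partial>gauss t)"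
    if [measurable]: "A \<in> sets borel" for A :: "'a set"
  proof -
    have "emeasure (distr (gauss s \<Otimes>\<^sub>M gauss t) borel (\<lambda>(x, y). x + y)) A
      = (\<integral>\<^sup>+w. indicator A w \<partial>distr (gauss s \<Otimes>\<^sub>M gauss t) borel (\<lambda>(x, y). x + y))"
      by simp
    also have "\<dots> = (\<integral>\<^sup>+p. indicator A (fst p + snd p) \<partial>(gauss s \<Otimes>\<^sub>M gauss t))"
      by (subst nn_integral_distr) (auto simp: case_prod_beta)
    also have "\<dots> = (\<integral>\<^sup>+y. \<integral>\<^sup>+x. indicator A (x + y) \<partial>gauss s \<partial>gauss t)"
      by (subst nn_integral_snd[symmetric]) auto
    finally show ?thesis .
  qed
  have rhs: "emeasure (gauss r) A = (\<integral>\<^sup>+x. indicator A x \<partial>gauss r)"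
    if "A \<in> sets borel" for A :: "'a set" and r using that by simp
  consider "s = 0" | "t = 0" "0 < s" | "0 < s" "0 < t" using assms by force
  then show ?thesis
  proof cases
    case 1
    show ?thesis
      by (rule measure_eqI, simp, subst lhs, simp, subst rhs, simp)
         (use 1 assms in \<open>auto simp: gauss_def nn_integral_return intro!: nn_integral_cong\<close>)
  next
    case 2
    have "emeasure (distr (gauss s \<Otimes>\<^sub>M gauss t) borel (\<lambda>(x, y). x + y)) A = emeasure (gauss s) A"
      if [measurable]: "A \<in> sets borel" for A :: "'a set"
      unfolding lhs[OF that] using 2 that by (simp add: gauss_def[of 0] nn_integral_return)
    then show ?thesis using 2 by (intro measure_eqI) auto
  next
    case 3
    define r where "r = sqrt (s\<^sup>2 + t\<^sup>2)"
    have r: "0 < r" using 3 by (simp add: r_def add_pos_pos)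
    \<comment> \<open>Both densities are products over the basis, so the convolution reduces to the
      one-dimensional identity in each coordinate.\<close>
    have conv: "(\<integral>\<^sup>+y. ennreal (gauss_density s (x - y)) * ennreal (gauss_density t y) \<partial>lborel)
        = ennreal (gauss_density r x)" for x :: 'a
    proof -
      have "(\<integral>\<^sup>+y. ennreal (gauss_density s (x - y)) * ennreal (gauss_density t y) \<partial>lborel)
        = (\<integral>\<^sup>+y. (\<Prod>b\<in>Basis. ennreal (normal_density 0 s (x \<bullet> b - y \<bullet> b) * normal_density 0 t (y \<bullet> b))) \<partial>lborel)"
        by (simp add: ennreal_gauss_density prod.distrib ennreal_mult inner_diff_left)
      also have "\<dots> = (\<Prod>b\<in>Basis. (\<integral>\<^sup>+y. ennreal (normal_density 0 s (x \<bullet> b - y) * normal_density 0 t y) \<partial>lborel))"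
        by (rule nn_integral_lborel_prod) auto
      also have "\<dots> = ennreal (gauss_density r x)"
        unfolding ennreal_gauss_density r_def
        using conv_normal_density_zero_mean[OF 3] by (intro prod.cong refl) (auto simp: fun_eq_iff)
      finally show ?thesis .
    qed
    have "emeasure (distr (gauss s \<Otimes>\<^sub>M gauss t) borel (\<lambda>(x, y). x + y)) A = emeasure (gauss r) A"
      if [measurable]: "A \<in> sets borel" for A :: "'a set"
    proof -
      have "(\<integral>\<^sup>+y. \<integral>\<^sup>+x. indicator A (x + y) \<partial>gauss s \<partial>gauss t)
        = (\<integral>\<^sup>+y. ennreal (gauss_density t y) * (\<integral>\<^sup>+x. ennreal (gauss_density s x) * indicator A (x + y) \<partial>lborel) \<partial>lborel)"
        using 3 by (simp add: gauss_def nn_integral_density)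
      also have "\<dots> = (\<integral>\<^sup>+y. ennreal (gauss_density t y) * (\<integral>\<^sup>+x. ennreal (gauss_density s (x - y)) * indicator A x \<partial>lborel) \<partial>lborel)"
      proof (rule nn_integral_cong)
        fix y :: 'a
        have *: "distr lborel borel (\<lambda>z. y + z) = lborel"
          using lborel_distr_plus[of y] by simp
        have "(\<integral>\<^sup>+x. ennreal (gauss_density s x) * indicator A (x + y) \<partial>lborel)
          = (\<integral>\<^sup>+x. ennreal (gauss_density s (x - y)) * indicator A x \<partial>lborel)"
          by (subst (2) *[symmetric], subst nn_integral_distr) (auto simp: add.commute)
        then show "ennreal (gauss_density t y) * (\<integral>\<^sup>+x. ennreal (gauss_density s x) * indicator A (x + y) \<partial>lborel)
          = ennreal (gauss_density t y) * (\<integral>\<^sup>+x. ennreal (gauss_density s (x - y)) * indicator A x \<partial>lborel)"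
          by simp
      qed
      also have "\<dots> = (\<integral>\<^sup>+y. \<integral>\<^sup>+x. ennreal (gauss_density t y) * (ennreal (gauss_density s (x - y)) * indicator A x) \<partial>lborel \<partial>lborel)"
        by (simp add: nn_integral_cmult)
      also have "\<dots> = (\<integral>\<^sup>+x. \<integral>\<^sup>+y. ennreal (gauss_density t y) * (ennreal (gauss_density s (x - y)) * indicator A x) \<partial>lborel \<partial>lborel)"
        by (rule lborel_pair.Fubini') simp
      also have "\<dots> = (\<integral>\<^sup>+x. (\<integral>\<^sup>+y. ennreal (gauss_density s (x - y)) * ennreal (gauss_density t y) \<partial>lborel) * indicator A x \<partial>lborel)"
        by (subst nn_integral_multc[symmetric]) (auto simp: mult_ac)
      also have "\<dots> = emeasure (gauss r) A"
        using r by (simp add: conv gauss_def emeasure_density)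
      finally show ?thesis using lhs[OF that] by simp
    qed
    then show ?thesis by (intro measure_eqI) (auto simp: r_def)
  qed
qed

text \<open>Variances add under convolution. Since the right-hand side is symmetric in
  \<open>s\<close> and \<open>t\<close>, smoothings at different scales commute.\<close>

lemma smooth_smooth:
  assumes "0 \<le> s" "0 \<le> t" "unit_valued \<phi>"
  shows "smooth s (smooth t \<phi>) = smooth (sqrt (s\<^sup>2 + t\<^sup>2)) (\<phi> :: 'a::euclidean_space \<Rightarrow> real)"
proof
  fix x
  interpret S: prob_space "gauss s :: 'a measure" by (rule prob_space_gauss) fact
  interpret T: prob_space "gauss t :: 'a measure" by (rule prob_space_gauss) fact
  interpret pair_prob_space "gauss s :: 'a measure" "gauss t :: 'a measure" ..
  note [measurable] = unit_valuedD(1)[OF assms(3)]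
  have "smooth (sqrt (s\<^sup>2 + t\<^sup>2)) \<phi> x
    = (LINT p|(gauss s \<Otimes>\<^sub>M gauss t). \<phi> (x + (fst p + snd p)))"
    unfolding smooth_def convolution_gauss[OF assms(1,2), symmetric]
    by (subst integral_distr) (auto simp: case_prod_beta)
  also have "\<dots> = (LINT y|gauss s. LINT z|gauss t. \<phi> (x + (fst (y, z) + snd (y, z))))"
  proof (rule integral_fst'[symmetric])
    have fm: "finite_measure (gauss s \<Otimes>\<^sub>M gauss t :: ('a \<times> 'a) measure)"
      using prob_space_axioms by (simp add: prob_space_def)
    show "integrable (gauss s \<Otimes>\<^sub>M gauss t) (\<lambda>p. \<phi> (x + (fst p + snd p)))"
      by (rule integrable_unit_valued[OF fm assms(3)]) measurable
  qed
  also have "\<dots> = smooth s (smooth t \<phi>) x"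
    by (simp add: smooth_def add.assoc)
  finally show "smooth s (smooth t \<phi>) x = smooth (sqrt (s\<^sup>2 + t\<^sup>2)) \<phi> x" by simp
qed

section \<open>From estimates on smoothings to absolute continuity\<close>

lemma measure_gauss_UNIV: "0 \<le> s \<Longrightarrow> measure (gauss s) UNIV = 1"
  using prob_space.prob_space[OF prob_space_gauss] by simp

text \<open>The density is bounded by its peak value. The factor blows up as \<open>s\<close> tends
  to 0, which is harmless when \<open>U\<close> is chosen after \<open>s\<close>.\<close>

lemma smooth_le_lborel:
  fixes U :: "'a::euclidean_space set"
  assumes s: "0 < s" and [measurable]: "U \<in> sets borel" and fin: "emeasure lborel U < \<infinity>"
  shows "smooth s (indicator U) x \<le> (1 / sqrt (2 * pi * s\<^sup>2)) ^ DIM('a) * measure lborel U"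
proof -
  define c where "c = (1 / sqrt (2 * pi * s\<^sup>2)) ^ DIM('a)"
  have U: "unit_valued (indicator U :: 'a \<Rightarrow> real)" by (intro unit_valuedI) auto
  have "smooth s (indicator U) x \<le> (LINT z|lborel. c * indicator U z)"
    unfolding smooth_lborel(1)[OF s U]
  proof (rule integral_mono)
    show "integrable lborel (\<lambda>z. indicator U z * gauss_density s (z - x))"
      by (rule smooth_lborel(2)[OF s U])
    show "integrable lborel (\<lambda>z. c * indicator U z)"
      using fin by (intro integrable_mult_right integrable_real_indicator) auto
    show "indicator U z * gauss_density s (z - x) \<le> c * indicator U z" for z
      using gauss_density_le[OF s, of "z - x"] by (auto simp: c_def split: split_indicator)
  qed
  then show ?thesis by (simp add: c_def)
qed

text \<open>Markov's inequality for the norm of a Gaussian vector: leaving \<open>U\<close> from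
  \<open>x\<close> requires a displacement of at least \<open>e\<close>.\<close>

lemma one_minus_smooth_le:
  fixes U :: "'a::euclidean_space set"
  assumes s: "0 \<le> s" and [measurable]: "U \<in> sets borel" and e: "0 < e" "ball x e \<subseteq> U"
  shows "1 - smooth s (indicator U) x \<le> real DIM('a) * s / e"
proof -
  interpret prob_space "gauss s :: 'a measure" by (rule prob_space_gauss) fact
  have U: "unit_valued (indicator U :: 'a \<Rightarrow> real)" by (intro unit_valuedI) auto
  have i: "integrable (gauss s) (\<lambda>z. indicator U (x + z) :: real)"
    by (rule integrable_unit_valued[OF finite_measure_axioms U]) simp
  have "1 - smooth s (indicator U) x = (LINT z|gauss s. 1 - indicator U (x + z))"
    using i by (simp add: smooth_def measure_gauss_UNIV[OF s])
  also have "\<dots> \<le> (LINT z|gauss s. norm (z::'a) / e)"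
  proof (rule integral_mono)
    show "1 - indicator U (x + z) \<le> norm z / e" for z
    proof (cases "norm z < e")
      case True
      then have "x + z \<in> ball x e" by (simp add: dist_norm)
      then show ?thesis using e by auto
    qed (use e in \<open>auto split: split_indicator\<close>)
  qed (use i integral_gauss_norm_le(1)[OF s] in auto)
  also have "\<dots> \<le> real DIM('a) * s / e"
    using integral_gauss_norm_le(2)[OF s, where 'a='a] e by (simp add: divide_right_mono)
  finally show ?thesis .
qed

text \<open>The indicator of an open set is at most the lower limit of its smoothings, so the
  telescoped bound compares the measure of an open set with that of a smoothing, whose mass is
  controlled by Lebesgue measure; null sets follow by outer regularity.\<close>

lemma absolutely_continuous_if_smoothings_Cauchy:
  fixes N :: "'a::euclidean_space measure" and r C :: real
  assumes N: "prob_space N" and sets_N: "sets N = sets borel"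
    and r: "0 \<le> r" "r < 1" and C: "0 \<le> C"
    and step: "\<And>n \<phi>. n0 \<le> n \<Longrightarrow> unit_valued \<phi> \<Longrightarrow>
      \<bar>(LINT x|N. smooth ((1/2)^n) \<phi> x) - (LINT x|N. smooth ((1/2)^Suc n) \<phi> x)\<bar> \<le> C * r^n"
  shows "absolutely_continuous lborel N"
proof -
  interpret N: prob_space N by fact
  note [measurable_cong] = sets_N
  have spN: "space N = UNIV" using sets_eq_imp_space_eq[OF sets_N] by simp
  have smooth_int: "integrable N (smooth s \<phi>)" if "0 \<le> s" "unit_valued \<phi>" for s and \<phi> :: "'a \<Rightarrow> real"
    using integrable_unit_valued[OF N.finite_measure_axioms smooth_unit_valued[OF that], of "\<lambda>x. x"] by simp
  have open_le: "N.prob U \<le> (LINT x|N. smooth ((1/2)^n) (indicator U) x) + C * r^n / (1 - r)"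
    if U: "open U" and n: "n0 \<le> n" for U n
  proof -
    have [measurable]: "U \<in> sets borel" using U by simp
    define I where "I k = (LINT x|N. smooth ((1/2)^k) (indicator U) x)" for k
    have \<phi>: "unit_valued (indicator U :: 'a \<Rightarrow> real)" by (intro unit_valuedI) auto
    have tele: "I (n + k) \<le> I n + C * r^n * (\<Sum>i<k. r^i)" for k
    proof (induction k)
      case (Suc k)
      have "I (n + Suc k) \<le> I (n + k) + C * r^(n + k)"
        using step[OF _ \<phi>, of "n + k"] n by (simp add: I_def)
      with Suc show ?case by (simp add: algebra_simps power_add)
    qed simp
    have I_le: "I (n + k) \<le> I n + C * r^n / (1 - r)" for k
    proof -
      have "(\<Sum>i<k. r^i) \<le> 1 / (1 - r)"
        using sum_le_suminf[of "\<lambda>i. r^i" "{..<k}"] suminf_geometric[of r] r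
        by (simp add: summable_geometric)
      then have "C * r^n * (\<Sum>i<k. r^i) \<le> C * r^n * (1 / (1 - r))"
        using C r by (intro mult_left_mono) auto
      with tele[of k] show ?thesis by simp
    qed
    \<comment> \<open>Multiplying by the indicator discards points outside \<open>U\<close>, where
      the smoothings may have a positive limit, for example on the boundary. On \<open>U\<close>
      they tend to 1 by openness, and the product stays below the smoothing.\<close>
    have lim: "(\<lambda>k. LINT x|N. smooth ((1/2)^(n + k)) (indicator U) x * indicator U x)
      \<longlonglongrightarrow> (LINT x|N. indicator U x :: real)"
    proof (rule integral_dominated_convergence[where w="\<lambda>_. 1"])
      have uv: "unit_valued (smooth ((1/2)^(n + k)) (indicator U) :: 'a \<Rightarrow> real)" for k
        using \<phi> by (intro smooth_unit_valued) auto
      show "(\<lambda>x. smooth ((1/2)^(n + k)) (indicator U) x * indicator U x) \<in> borel_measurable N" for k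
        using unit_valuedD(1)[OF uv, of k] by measurable
      show "AE x in N. norm (smooth ((1/2)^(n + k)) (indicator U) x * indicator U x :: real) \<le> 1" for k
        by (intro AE_I2) (simp add: abs_mult unit_valuedD[OF uv] mult_le_one split: split_indicator)
      have "(\<lambda>k. smooth ((1/2)^(n + k)) (indicator U) x * indicator U x) \<longlonglongrightarrow> (indicator U x :: real)" for x
      proof (cases "x \<in> U")
        case True
        then obtain e where e: "0 < e" "ball x e \<subseteq> U" using U open_contains_ball by blast
        have "(\<lambda>k. smooth ((1/2)^(n + k)) (indicator U) x) \<longlonglongrightarrow> (1::real)"
        proof (rule tendsto_sandwich[OF always_eventually always_eventually])
          show "\<forall>k. 1 - real DIM('a) * (1/2)^(n + k) / e \<le> smooth ((1/2)^(n + k)) (indicator U) x"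
            using one_minus_smooth_le[of "(1/2)^(n + k)" U e x for k] e by (auto simp: algebra_simps)
          show "\<forall>k. smooth ((1/2)^(n + k)) (indicator U) x \<le> (1::real)"
            using unit_valuedD(3)[OF uv] by auto
          have "(\<lambda>k. 1 - real DIM('a) * ((1/2)^n * (1/2)^k) / e) \<longlonglongrightarrow> 1 - real DIM('a) * ((1/2)^n * 0) / e"
            by (intro tendsto_intros LIMSEQ_power_zero) (use e in auto)
          then show "(\<lambda>k. 1 - real DIM('a) * (1/2)^(n + k) / e) \<longlonglongrightarrow> 1" by (simp add: power_add)
        qed simp
        with True show ?thesis by simp
      qed simp
      then show "AE x in N. (\<lambda>k. smooth ((1/2)^(n + k)) (indicator U) x * indicator U x) \<longlonglongrightarrow> (indicator U x :: real)"
        by simp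
    qed auto
    have "(LINT x|N. indicator U x) \<le> I n + C * r^n / (1 - r)"
    proof (rule LIMSEQ_le_const2[OF lim], intro exI allI impI)
      fix k :: nat
      have uv: "unit_valued (smooth ((1/2)^(n + k)) (indicator U) :: 'a \<Rightarrow> real)" for k
        using \<phi> by (intro smooth_unit_valued) auto
      note [measurable] = unit_valuedD(1)[OF uv]
      have "(LINT x|N. smooth ((1/2)^(n + k)) (indicator U) x * indicator U x) \<le> I (n + k)"
        unfolding I_def
      proof (rule integral_mono)
        show i: "integrable N (smooth ((1/2)^(n + k)) (indicator U))" by (rule smooth_int) (use \<phi> in auto)
        show "integrable N (\<lambda>x. smooth ((1/2)^(n + k)) (indicator U) x * indicator U x :: real)"
          by (rule Bochner_Integration.integrable_bound[OF i])
             (auto simp: unit_valuedD[OF uv] split: split_indicator)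
      qed (auto simp: unit_valuedD[OF uv] split: split_indicator)
      with I_le[of k] show "(LINT x|N. smooth ((1/2)^(n + k)) (indicator U) x * indicator U x) \<le> I n + C * r^n / (1 - r)"
        by simp
    qed
    then show ?thesis by (simp add: I_def spN)
  qed
  show ?thesis
    unfolding absolutely_continuous_def
  proof
    fix B :: "'a set" assume "B \<in> null_sets lborel"
    then have B[measurable]: "B \<in> sets borel" and B0: "emeasure lborel B = 0" by auto
    have "N.prob B \<le> 0"
    proof (rule field_le_epsilon)
      fix e :: real assume e: "0 < e"
      have "(\<lambda>n. C * r^n / (1 - r)) \<longlonglongrightarrow> C * 0 / (1 - r)"
        by (intro tendsto_intros LIMSEQ_power_zero) (use r in auto)
      then have "\<forall>\<^sub>F n in sequentially. C * r^n / (1 - r) < e / 2"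
        by (rule order_tendstoD) (use e in auto)
      then have "\<forall>\<^sub>F n in sequentially. C * r^n / (1 - r) < e / 2 \<and> n0 \<le> n"
        using eventually_ge_at_top by (rule eventually_conj)
      then obtain n where n: "C * r^n / (1 - r) < e / 2" "n0 \<le> n"
        by (auto dest: eventually_happens)
      define s :: real where "s = (1/2)^n"
      define c where "c = (1 / sqrt (2 * pi * s\<^sup>2)) ^ DIM('a)"
      have s: "0 < s" by (simp add: s_def)
      have c: "0 < c" using s by (simp add: c_def)
      \<comment> \<open>The index \<open>n\<close>, hence the scale \<open>s\<close> and the peak
        value \<open>c\<close>, is fixed before \<open>U\<close>. The tolerance makes
        \<open>c\<close> times the measure of \<open>U\<close> at most \<open>e / 2\<close>; the
        other half of \<open>e\<close> pays for the geometric tail.\<close>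
      obtain U where U: "open U" "B \<subseteq> U" "emeasure lborel (U - B) < ennreal (e / (2 * c))"
        using outer_regular_lborel[OF B, of "e / (2 * c)"] e c by auto
      have [measurable]: "U \<in> sets borel" using U by simp
      have "emeasure lborel U \<le> emeasure lborel (U - B) + emeasure lborel B"
        using U by (subst plus_emeasure) (auto simp: Un_absorb2)
      with B0 U have U_lt: "emeasure lborel U < ennreal (e / (2 * c))" by simp
      have U_fin: "emeasure lborel U < \<infinity>" by (rule order.strict_trans[OF U_lt]) simp
      have "measure lborel U \<le> e / (2 * c)"
        using U_lt e c unfolding measure_def by (intro enn2real_leI) auto
      then have cU: "c * measure lborel U \<le> e / 2" using c by (simp add: field_simps)
      have \<phi>: "unit_valued (indicator U :: 'a \<Rightarrow> real)" by (intro unit_valuedI) auto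
      have "(LINT x|N. smooth s (indicator U) x) \<le> (LINT x|N. c * measure lborel U)"
        using smooth_le_lborel[OF s _ U_fin] smooth_int[OF _ \<phi>, of s] s
        by (intro integral_mono) (auto simp: c_def)
      then have "(LINT x|N. smooth s (indicator U) x) \<le> e / 2"
        using cU by (simp add: N.prob_space)
      then have "(LINT x|N. smooth s (indicator U) x) + C * r^n / (1 - r) \<le> e / 2 + e / 2"
        using n(1) by (intro add_mono) auto
      moreover have "N.prob B \<le> N.prob U"
        using U by (intro N.finite_measure_mono) auto
      ultimately show "N.prob B \<le> 0 + e"
        using open_le[OF U(1) n(2)] unfolding s_def by linarith
    qed
    then have "emeasure N B = 0"
      by (simp add: N.emeasure_eq_measure measure_le_0_iff)
    then show "B \<in> null_sets N" by (simp add: null_sets_def sets_N)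
  qed
qed

section \<open>Comparing two smoothing scales along a random variable\<close>

lemma smooth_minus_self_le:
  fixes \<psi> :: "'a::euclidean_space \<Rightarrow> real"
  assumes s: "0 \<le> s" and \<psi>: "unit_valued \<psi>" and L: "0 \<le> L"
    and Lip: "\<And>x y. \<bar>\<psi> x - \<psi> y\<bar> \<le> L * norm (x - y)"
  shows "\<bar>smooth s \<psi> x - \<psi> x\<bar> \<le> L * (real DIM('a) * s)"
proof -
  interpret prob_space "gauss s :: 'a measure" by (rule prob_space_gauss) fact
  have i: "integrable (gauss s) (\<lambda>z. \<psi> (x + z))"
    by (rule integrable_unit_valued[OF finite_measure_axioms \<psi>]) simp
  have "smooth s \<psi> x - \<psi> x = (LINT z|gauss s. \<psi> (x + z) - \<psi> x)"
    using i by (simp add: smooth_def measure_gauss_UNIV[OF s])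
  also have "\<bar>\<dots>\<bar> \<le> (LINT z|gauss s. L * norm (z::'a))"
    using i integral_gauss_norm_le(1)[OF s, where 'a='a] Lip[of "x + z" x for z]
    by (intro order_trans[OF integral_abs_bound] integral_mono) auto
  also have "\<dots> \<le> L * (real DIM('a) * s)"
    using integral_gauss_norm_le[OF s, where 'a='a] L by (simp add: mult_left_mono)
  finally show ?thesis .
qed

text \<open>An L1 error is paid for by the Lipschitz constant of the smoothed test function. No
  relation between the joint laws of \<open>X\<close> and \<open>Z\<close> enters beyond this
  error.\<close>

lemma (in prob_space) smooth_expectation_perturb:
  fixes X Z :: "'a \<Rightarrow> 'b::euclidean_space"
  assumes \<phi>: "unit_valued \<phi>" and s: "0 < s" and k: "0 \<le> \<kappa>"
    and [measurable]: "X \<in> borel_measurable M" "Z \<in> borel_measurable M"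
    and XZ: "(\<integral>\<^sup>+\<omega>. ennreal (norm (X \<omega> - Z \<omega>)) \<partial>M) \<le> ennreal \<kappa>"
  shows "\<bar>expectation (\<lambda>\<omega>. smooth s \<phi> (X \<omega>)) - expectation (\<lambda>\<omega>. smooth s \<phi> (Z \<omega>))\<bar>
    \<le> (2 * real DIM('b) + 1) / s * \<kappa>"
proof -
  have uv: "unit_valued (smooth s \<phi>)" by (rule smooth_unit_valued) (use \<phi> s in auto)
  have i: "integrable M (\<lambda>\<omega>. smooth s \<phi> (X \<omega>))" "integrable M (\<lambda>\<omega>. smooth s \<phi> (Z \<omega>))"
    by (rule integrable_unit_valued[OF finite_measure_axioms uv], simp)+
  have n: "integrable M (\<lambda>\<omega>. norm (X \<omega> - Z \<omega>))"
    using XZ by (intro integrableI_nonneg) (auto intro: le_less_trans)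
  have nk: "expectation (\<lambda>\<omega>. norm (X \<omega> - Z \<omega>)) \<le> \<kappa>"
    using XZ k by (subst integral_eq_nn_integral) (auto intro!: enn2real_leI)
  have "expectation (\<lambda>\<omega>. smooth s \<phi> (X \<omega>)) - expectation (\<lambda>\<omega>. smooth s \<phi> (Z \<omega>))
    = expectation (\<lambda>\<omega>. smooth s \<phi> (X \<omega>) - smooth s \<phi> (Z \<omega>))"
    using i by simp
  also have "\<bar>\<dots>\<bar> \<le> expectation (\<lambda>\<omega>. (2 * real DIM('b) + 1) / s * norm (X \<omega> - Z \<omega>))"
    using i n smooth_Lipschitz[OF s \<phi>]
    by (intro order_trans[OF integral_abs_bound] integral_mono) auto
  also have "\<dots> \<le> (2 * real DIM('b) + 1) / s * \<kappa>"
    using nk s by (simp only: integral_mult_right_zero) (intro mult_left_mono, auto)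
  finally show ?thesis .
qed

text \<open>The core estimate. The last hypothesis says that, in law, \<open>Z\<close> is
  \<open>V\<close> plus an independent Gaussian of deviation \<open>\<sigma>\<close>. At both scales
  the expectation is compared with the same reference value, that of
  \<open>smooth \<sigma> \<phi>\<close> at \<open>V\<close>, in two moves: from \<open>X\<close> to
  \<open>Z\<close>, then dropping the fine smoothing.\<close>

lemma (in prob_space) smooth_expectation_diff_le:
  fixes X Z V :: "'a \<Rightarrow> 'b::euclidean_space"
  assumes \<phi>: "unit_valued \<phi>" and s: "0 < s" and t: "0 < t" and \<sigma>: "0 < \<sigma>" and k: "0 \<le> \<kappa>"
    and [measurable]: "X \<in> borel_measurable M" "Z \<in> borel_measurable M" "V \<in> borel_measurable M"
    and XZ: "(\<integral>\<^sup>+\<omega>. ennreal (norm (X \<omega> - Z \<omega>)) \<partial>M) \<le> ennreal \<kappa>"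
    and Z: "\<And>\<psi>. unit_valued \<psi> \<Longrightarrow> expectation (\<lambda>\<omega>. \<psi> (Z \<omega>)) = expectation (\<lambda>\<omega>. smooth \<sigma> \<psi> (V \<omega>))"
  shows "\<bar>expectation (\<lambda>\<omega>. smooth s \<phi> (X \<omega>)) - expectation (\<lambda>\<omega>. smooth t \<phi> (X \<omega>))\<bar>
    \<le> (2 * real DIM('b) + 1) * (\<kappa> / s + \<kappa> / t + real DIM('b) * (s + t) / \<sigma>)"
proof -
  let ?L = "2 * real DIM('b) + 1"
  define \<psi> where "\<psi> = smooth \<sigma> \<phi>"
  have \<psi>: "unit_valued \<psi>" unfolding \<psi>_def by (rule smooth_unit_valued) (use \<phi> \<sigma> in auto)
  have key: "\<bar>expectation (\<lambda>\<omega>. smooth s \<phi> (Z \<omega>)) - expectation (\<lambda>\<omega>. \<psi> (V \<omega>))\<bar>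
      \<le> ?L / \<sigma> * (real DIM('b) * s)" if s: "0 < s" for s
  proof -
    have uv: "unit_valued (smooth s \<phi>)" "unit_valued (smooth s \<psi>)"
      by (rule smooth_unit_valued, use \<phi> \<psi> s in auto)+
    \<comment> \<open>Commuting the smoothings puts the coarse one inside, so the fine one acts on
      \<open>\<psi>\<close>, whose Lipschitz constant is governed by \<open>\<sigma>\<close> and not
      by \<open>s\<close>.\<close>
    have "smooth \<sigma> (smooth s \<phi>) = smooth s \<psi>"
      using s \<sigma> \<phi> by (simp add: \<psi>_def smooth_smooth add.commute)
    then have "expectation (\<lambda>\<omega>. smooth s \<phi> (Z \<omega>)) = expectation (\<lambda>\<omega>. smooth s \<psi> (V \<omega>))"
      using Z[OF uv(1)] by simp
    moreover have i: "integrable M (\<lambda>\<omega>. smooth s \<psi> (V \<omega>))" "integrable M (\<lambda>\<omega>. \<psi> (V \<omega>))"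
      by (rule integrable_unit_valued[OF finite_measure_axioms], use uv \<psi> in auto)+
    ultimately have "expectation (\<lambda>\<omega>. smooth s \<phi> (Z \<omega>)) - expectation (\<lambda>\<omega>. \<psi> (V \<omega>))
      = expectation (\<lambda>\<omega>. smooth s \<psi> (V \<omega>) - \<psi> (V \<omega>))" by simp
    also have "\<bar>\<dots>\<bar> \<le> expectation (\<lambda>\<omega>. ?L / \<sigma> * (real DIM('b) * s))"
      using i smooth_minus_self_le[of s \<psi> "?L / \<sigma>"] smooth_Lipschitz[OF \<sigma> \<phi>] s \<sigma> \<psi>
      by (intro order_trans[OF integral_abs_bound] integral_mono) (auto simp: \<psi>_def)
    finally show ?thesis by (simp add: prob_space)
  qed
  have "\<bar>expectation (\<lambda>\<omega>. smooth s \<phi> (X \<omega>)) - expectation (\<lambda>\<omega>. smooth t \<phi> (X \<omega>))\<bar>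
    \<le> ?L / s * \<kappa> + ?L / t * \<kappa> + ?L / \<sigma> * (real DIM('b) * s) + ?L / \<sigma> * (real DIM('b) * t)"
    using key[OF s] key[OF t] smooth_expectation_perturb[OF \<phi> s k _ _ XZ]
      smooth_expectation_perturb[OF \<phi> t k _ _ XZ] by simp
  also have "\<dots> = ?L * (\<kappa> / s + \<kappa> / t + real DIM('b) * (s + t) / \<sigma>)"
    by (simp add: add_divide_distrib algebra_simps)
  finally show ?thesis .
qed

section \<open>Gaussian innovations of Brownian step integrals\<close>

lemma distr_scaleR_gauss:
  assumes s: "0 \<le> s"
  shows "distr (gauss s) borel (\<lambda>x. c *\<^sub>R x) = (gauss (\<bar>c\<bar> * s) :: 'a::euclidean_space measure)"
proof -
  interpret prob_space "gauss s :: 'a measure" by (rule prob_space_gauss) fact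
  consider "s = 0" | "c = 0" | "0 < s" "c \<noteq> 0" using s by force
  then show ?thesis
  proof cases
    case 1
    then show ?thesis by (simp add: gauss_def distr_return)
  next
    case 2
    have "distr (gauss s :: 'a measure) borel (\<lambda>x. 0) = (return borel 0 :: 'a measure)"
      by (rule distr_const) simp
    then show ?thesis using 2 by (simp add: gauss_def[of 0])
  next
    case 3
    have cs: "0 < \<bar>c\<bar> * s" using 3 by simp
    \<comment> \<open>The Jacobian of the dilation cancels the change in the normalising
      constant.\<close>
    have dens: "\<bar>c\<bar> ^ DIM('a) * gauss_density (\<bar>c\<bar> * s) (c *\<^sub>R x) = gauss_density s x" for x :: 'a
    proof -
      have "sqrt (2 * pi * (\<bar>c\<bar> * s)\<^sup>2) = \<bar>c\<bar> * sqrt (2 * pi * s\<^sup>2)"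
        by (simp add: power_mult_distrib real_sqrt_mult)
      moreover have "- (norm (c *\<^sub>R x))\<^sup>2 / (2 * (\<bar>c\<bar> * s)\<^sup>2) = - (norm x)\<^sup>2 / (2 * s\<^sup>2)"
        using 3 by (simp add: power_mult_distrib)
      ultimately show ?thesis
        using 3 by (simp add: gauss_density_eq[OF cs] gauss_density_eq[OF 3(1)] power_mult_distrib power_divide)
    qed
    show ?thesis
    proof (rule measure_eqI)
      fix A :: "'a set" assume "A \<in> sets (distr (gauss s) borel (\<lambda>x. c *\<^sub>R x))"
      then have [measurable]: "A \<in> sets borel" by simp
      have "emeasure (gauss (\<bar>c\<bar> * s)) A
        = (\<integral>\<^sup>+y. ennreal (gauss_density (\<bar>c\<bar> * s) y) * indicator A y \<partial>(lborel :: 'a measure))"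
        using 3 by (simp add: gauss_def emeasure_density)
      also have "\<dots> = (\<integral>\<^sup>+x. ennreal (\<bar>c\<bar> ^ DIM('a)) *
          (ennreal (gauss_density (\<bar>c\<bar> * s) (c *\<^sub>R x)) * indicator A (c *\<^sub>R x)) \<partial>(lborel :: 'a measure))"
        by (subst lborel_affine[OF 3(2), of 0]) (simp add: nn_integral_density nn_integral_distr)
      also have "\<dots> = (\<integral>\<^sup>+x. ennreal (gauss_density s x) * indicator A (c *\<^sub>R x) \<partial>(lborel :: 'a measure))"
        by (intro nn_integral_cong) (simp add: dens[symmetric] ennreal_mult mult.assoc)
      also have "\<dots> = emeasure (distr (gauss s) borel (\<lambda>x. c *\<^sub>R x)) A"
      proof -
        have "emeasure (distr (gauss s) borel (\<lambda>x. c *\<^sub>R x)) A = (\<integral>\<^sup>+x. indicator A x \<partial>distr (gauss s) borel (\<lambda>x. c *\<^sub>R x))"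
          by simp
        also have "\<dots> = (\<integral>\<^sup>+x. indicator A (c *\<^sub>R x) \<partial>gauss s)"
          by (rule nn_integral_distr) auto
        also have "\<dots> = (\<integral>\<^sup>+x. ennreal (gauss_density s x) * indicator A (c *\<^sub>R x) \<partial>(lborel :: 'a measure))"
          using 3 by (simp add: gauss_def nn_integral_density)
        finally show ?thesis by simp
      qed
      finally show "emeasure (distr (gauss s) borel (\<lambda>x. c *\<^sub>R x)) A = emeasure (gauss (\<bar>c\<bar> * s)) A" by simp
    qed simp
  qed
qed

text \<open>Independence makes the joint law of \<open>V\<close> and \<open>D\<close> a product, and
  Fubini integrates out \<open>D\<close> with \<open>V\<close> frozen; the inner integral is a
  smoothing.\<close>

lemma (in prob_space) expectation_add_indep_gauss:
  fixes V D :: "'a \<Rightarrow> 'b::euclidean_space"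
  assumes sub: "subalgebra M F" and V: "V \<in> borel_measurable F" and [measurable]: "D \<in> borel_measurable M"
    and indep: "indep_set (sets F) {D -` S \<inter> space M | S. S \<in> sets borel}"
    and D: "distr M borel D = gauss \<sigma>" and \<sigma>: "0 \<le> \<sigma>" and \<phi>: "unit_valued \<phi>"
  shows "expectation (\<lambda>\<omega>. \<phi> (V \<omega> + c *\<^sub>R D \<omega>)) = expectation (\<lambda>\<omega>. smooth (\<bar>c\<bar> * \<sigma>) \<phi> (V \<omega>))"
proof -
  have spF: "space F = space M" and sF: "sets F \<subseteq> sets M" using sub by (auto simp: subalgebra_def)
  have [measurable]: "V \<in> borel_measurable M" using measurable_from_subalg[OF sub V] .
  note [measurable] = unit_valuedD(1)[OF \<phi>]
  have "sigma_sets (space M) {V -` A \<inter> space M | A. A \<in> sets borel} \<subseteq> sets F"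
    using measurable_sets[OF V] by (subst spF[symmetric], intro sets.sigma_sets_subset) (auto simp: spF)
  \<comment> \<open>Preimages of Borel sets already form a sigma-algebra, so the family in the
    definition of \<open>brownian_motion\<close> is the one generated by \<open>D\<close>.\<close>
  moreover have "sigma_sets (space M) {D -` A \<inter> space M | A. A \<in> sets borel} = {D -` S \<inter> space M | S. S \<in> sets borel}"
    by (simp add: sets_vimage_algebra[symmetric] sets_vimage_algebra2)
  ultimately have "indep_set (sigma_sets (space M) {V -` A \<inter> space M | A. A \<in> sets borel})
      (sigma_sets (space M) {D -` A \<inter> space M | A. A \<in> sets borel})"
    using indep unfolding indep_set_def by (elim indep_sets_mono_sets) (auto split: bool.split)
  then have "indep_var borel V borel D"
    by (simp add: indep_var_eq)
  then have joint: "distr M (borel \<Otimes>\<^sub>M borel) (\<lambda>\<omega>. (V \<omega>, D \<omega>)) = distr M borel V \<Otimes>\<^sub>M gauss \<sigma>"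
    by (simp add: indep_var_distribution_eq D)
  interpret V: prob_space "distr M borel V" by (rule prob_space_distr) simp
  interpret G: prob_space "gauss \<sigma> :: 'b measure" by (rule prob_space_gauss) fact
  interpret VG: pair_prob_space "distr M borel V" "gauss \<sigma> :: 'b measure" ..
  have "expectation (\<lambda>\<omega>. \<phi> (V \<omega> + c *\<^sub>R D \<omega>))
    = (LINT p|distr M (borel \<Otimes>\<^sub>M borel) (\<lambda>\<omega>. (V \<omega>, D \<omega>)). \<phi> (fst p + c *\<^sub>R snd p))"
    by (subst integral_distr) auto
  also have "\<dots> = (LINT v|distr M borel V. LINT d|gauss \<sigma>. \<phi> (fst (v, d) + c *\<^sub>R snd (v, d)))"
    unfolding joint
  proof (rule VG.integral_fst'[symmetric])
    show "integrable (distr M borel V \<Otimes>\<^sub>M gauss \<sigma>) (\<lambda>p. \<phi> (fst p + c *\<^sub>R snd p))"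
      by (rule integrable_unit_valued[OF VG.P.finite_measure_axioms \<phi>]) measurable
  qed
  also have "\<dots> = (LINT v|distr M borel V. smooth (\<bar>c\<bar> * \<sigma>) \<phi> v)"
    unfolding smooth_def distr_scaleR_gauss[OF \<sigma>, symmetric]
    by (subst (2) integral_distr) auto
  also have "\<dots> = expectation (\<lambda>\<omega>. smooth (\<bar>c\<bar> * \<sigma>) \<phi> (V \<omega>))"
    using unit_valuedD(1)[OF smooth_unit_valued[OF _ \<phi>, of "\<bar>c\<bar> * \<sigma>"]] \<sigma>
    by (subst integral_distr) auto
  finally show ?thesis .
qed

text \<open>Matches the product over \<open>Basis\<close> with the product over vector components
  that \<open>brownian_motion\<close> uses.\<close>

lemma gauss_density_vec: "gauss_density s (x :: real^'d) = (\<Prod>i\<in>UNIV. normal_density 0 s (vec_nth x i))"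
proof -
  have B: "(Basis :: (real^'d) set) = range (\<lambda>i. axis i 1)"
    by (auto simp: Basis_vec_def)
  have "inj (\<lambda>i::'d. axis i (1::real))" by (auto simp: inj_on_def axis_eq_axis)
  then show ?thesis
    unfolding gauss_density_def B by (subst prod.reindex) (auto simp: inner_axis)
qed

lemma brownian_increment_distr:
  assumes bm: "brownian_motion M T \<A> W" and st: "0 \<le> s" "s < t" "t \<le> T"
  shows "distr M borel (\<lambda>\<omega>. W t \<omega> - W s \<omega>) = gauss (sqrt (t - s))"
proof -
  have "distributed M lborel (\<lambda>\<omega>. W t \<omega> - W s \<omega>)
    (\<lambda>x. ennreal (\<Prod>i\<in>UNIV. normal_density 0 (sqrt (t - s)) (vec_nth x i)))"
    using bm st unfolding brownian_motion_def by blast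
  from distributed_distr_eq_density[OF this] st
  show ?thesis
    by (simp add: gauss_def gauss_density_vec cong: distr_cong)
qed

lemma measurable_filtration:
  assumes "filtration_upto M T \<A>" "s \<le> t" "0 \<le> s" "t \<le> T" "Y \<in> borel_measurable (\<A> s)"
  shows "Y \<in> borel_measurable (\<A> t)"
proof -
  have "subalgebra (\<A> t) (\<A> s)"
    using assms unfolding filtration_upto_def subalgebra_def by auto
  then show ?thesis using measurable_from_subalg assms(5) by blast
qed

text \<open>Induction on \<open>N\<close> removes the last increment: it is independent of
  everything up to \<open>q N\<close>, so integrating it out replaces \<open>\<phi>\<close> by a
  smoothing of \<open>\<phi>\<close>, which is why \<open>\<phi>\<close> is generalised.
  Measurability at the current grid time is carried along because the next application of
  independence needs it. The grid is strict since increments have a prescribed law only for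
  \<open>s < t\<close>.\<close>

lemma brownian_chain:
  fixes W :: "real \<Rightarrow> 'w \<Rightarrow> real ^ 'd"
  assumes M: "prob_space M" and filt: "filtration_upto M T \<A>" and bm: "brownian_motion M T \<A> W"
    and q: "\<And>i. i \<le> N \<Longrightarrow> 0 \<le> q i \<and> q i \<le> T" "\<And>i. i < N \<Longrightarrow> q i < q (Suc i)"
    and V: "V \<in> borel_measurable (\<A> (q m))" and mN: "m \<le> N" and \<phi>: "unit_valued \<phi>"
  shows "(\<lambda>\<omega>. V \<omega> + (\<Sum>j=m..<N. c j *\<^sub>R (W (q (Suc j)) \<omega> - W (q j) \<omega>))) \<in> borel_measurable (\<A> (q N)) \<and>
    (LINT \<omega>|M. \<phi> (V \<omega> + (\<Sum>j=m..<N. c j *\<^sub>R (W (q (Suc j)) \<omega> - W (q j) \<omega>))))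
     = (LINT \<omega>|M. smooth (sqrt (\<Sum>j=m..<N. (c j)\<^sup>2 * (q (Suc j) - q j))) \<phi> (V \<omega>))"
  using mN q \<phi>
proof (induction N arbitrary: \<phi> rule: dec_induct)
  case base
  then show ?case using V by (simp add: unit_valuedD(1))
next
  case (step N)
  interpret prob_space M by fact
  let ?Z = "\<lambda>\<omega>. V \<omega> + (\<Sum>j=m..<N. c j *\<^sub>R (W (q (Suc j)) \<omega> - W (q j) \<omega>))"
  let ?S = "\<Sum>j=m..<N. (c j)\<^sup>2 * (q (Suc j) - q j)"
  define \<sigma> where "\<sigma> = \<bar>c N\<bar> * sqrt (q (Suc N) - q N)"
  have q': "0 \<le> q N" "q N < q (Suc N)" "q (Suc N) \<le> T" "0 \<le> q (Suc N)" "q N \<le> T"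
    using step.prems(1)[of N] step.prems(1)[of "Suc N"] step.prems(2)[of N] by auto
  have \<sigma>: "0 \<le> \<sigma>" using q' by (simp add: \<sigma>_def)
  have Z: "?Z \<in> borel_measurable (\<A> (q N))" 
    using step.IH[OF _ _ step.prems(3)] step.prems by auto
  have W: "W s \<in> borel_measurable (\<A> s)" if "0 \<le> s" "s \<le> T" for s
    using bm that unfolding brownian_motion_def adapted_upto_def by auto
  have sub: "subalgebra M (\<A> s)" if "0 \<le> s" "s \<le> T" for s
    using filt that unfolding filtration_upto_def by auto
  have [measurable]: "W s \<in> borel_measurable M" if "0 \<le> s" "s \<le> T" for s
    using measurable_from_subalg[OF sub W] that by blast
  have S0: "0 \<le> ?S" using step.prems(2) by (intro sum_nonneg mult_nonneg_nonneg) (auto simp: less_imp_le)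
  have "expectation (\<lambda>\<omega>. \<phi> (?Z \<omega> + c N *\<^sub>R (W (q (Suc N)) \<omega> - W (q N) \<omega>)))
    = expectation (\<lambda>\<omega>. smooth \<sigma> \<phi> (?Z \<omega>))"
    unfolding \<sigma>_def
  proof (rule expectation_add_indep_gauss[OF sub[of "q N"] Z])
    show "indep_set (sets (\<A> (q N))) {(\<lambda>\<omega>. W (q (Suc N)) \<omega> - W (q N) \<omega>) -` S \<inter> space M |S. S \<in> sets borel}"
      using bm q' unfolding brownian_motion_def by blast
    show "distr M borel (\<lambda>\<omega>. W (q (Suc N)) \<omega> - W (q N) \<omega>) = gauss (sqrt (q (Suc N) - q N))"
      by (rule brownian_increment_distr[OF bm]) (use q' in auto)
  qed (use q' step.prems(3) in auto)
  also have "\<dots> = expectation (\<lambda>\<omega>. smooth (sqrt ?S) (smooth \<sigma> \<phi>) (V \<omega>))"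
    using step.IH[OF _ _ smooth_unit_valued[OF \<sigma> step.prems(3)]] step.prems by auto
  also have "smooth (sqrt ?S) (smooth \<sigma> \<phi>) = smooth (sqrt (\<Sum>j=m..<Suc N. (c j)\<^sup>2 * (q (Suc j) - q j))) \<phi>"
    using step.hyps smooth_smooth[OF _ \<sigma> step.prems(3), of "sqrt ?S"] S0 q'(2)
    by (simp add: \<sigma>_def power_mult_distrib)
  finally have "expectation (\<lambda>\<omega>. \<phi> (V \<omega> + (\<Sum>j=m..<Suc N. c j *\<^sub>R (W (q (Suc j)) \<omega> - W (q j) \<omega>))))
    = expectation (\<lambda>\<omega>. smooth (sqrt (\<Sum>j=m..<Suc N. (c j)\<^sup>2 * (q (Suc j) - q j))) \<phi> (V \<omega>))"
    using step.hyps by (simp add: add.assoc)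
  moreover have "(\<lambda>\<omega>. ?Z \<omega> + c N *\<^sub>R (W (q (Suc N)) \<omega> - W (q N) \<omega>)) \<in> borel_measurable (\<A> (q (Suc N)))"
    by (intro borel_measurable_add borel_measurable_scaleR borel_measurable_diff borel_measurable_const
         W q' measurable_filtration[OF filt less_imp_le[OF q'(2)] q'(1,3)] Z)
  ultimately show ?case
    using step.hyps by (simp add: add.assoc)
qed

section \<open>Step functions on a common grid\<close>

lemma sum_indicator_telescope:
  fixes w :: "nat \<Rightarrow> 'a::real_vector" and q :: "nat \<Rightarrow> real"
  assumes q: "strict_mono_on {..N} q" and ab: "a \<le> b" "b \<le> N"
  shows "(\<Sum>j<N. indicator {q a<..q b} (q (Suc j)) *\<^sub>R (w (Suc j) - w j)) = w b - w a"
proof -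
  have "(\<Sum>j<N. indicator {q a<..q b} (q (Suc j)) *\<^sub>R (w (Suc j) - w j))
    = (\<Sum>j<N. if j \<in> {a..<b} then w (Suc j) - w j else 0)"
  proof (rule sum.cong[OF refl])
    fix j assume "j \<in> {..<N}"
    then have "q a < q (Suc j) \<longleftrightarrow> a < Suc j" "q (Suc j) \<le> q b \<longleftrightarrow> Suc j \<le> b"
      using ab strict_mono_on_less[OF q, of a "Suc j"] strict_mono_on_less_eq[OF q, of "Suc j" b] by auto
    then show "indicator {q a<..q b} (q (Suc j)) *\<^sub>R (w (Suc j) - w j)
      = (if j \<in> {a..<b} then w (Suc j) - w j else 0)"
      by (auto simp: indicator_def)
  qed
  also have "\<dots> = (\<Sum>j\<in>{..<N} \<inter> {a..<b}. w (Suc j) - w j)"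
    by (simp add: sum.inter_restrict)
  also have "{..<N} \<inter> {a..<b} = {a..<b}" using ab by auto
  also have "(\<Sum>j=a..<b. w (Suc j) - w j) = w b - w a"
    using ab by (simp add: sum_Suc_diff')
  finally show ?thesis .
qed

lemma mono_on_image_index:
  fixes p q :: "nat \<Rightarrow> real"
  assumes p: "mono_on {..n} p" and q: "strict_mono_on {..N} q" and sub: "p ` {..n} \<subseteq> q ` {..N}" and i: "i < n"
  obtains a b where "p i = q a" "p (Suc i) = q b" "a \<le> b" "b \<le> N"
proof -
  have "p i \<in> q ` {..N}" "p (Suc i) \<in> q ` {..N}" using sub i by auto
  then obtain a b where ab: "p i = q a" "p (Suc i) = q b" "a \<le> N" "b \<le> N" by auto
  have "p i \<le> p (Suc i)" using p i by (auto simp: mono_on_def)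
  then have "a \<le> b" using ab strict_mono_on_less_eq[OF q, of a b] by auto
  with ab that show thesis by blast
qed

text \<open>Rewrites step integrals with different partitions over one grid so that they can be
  added cell by cell. The value on a cell is read off at its right endpoint because the intervals in
  \<open>step_fun\<close> are open on the left and closed on the right. Repeated points in
  \<open>p\<close> are allowed and contribute zero increments.\<close>

lemma step_integral_refine:
  fixes W :: "real \<Rightarrow> 'w \<Rightarrow> 'b::real_vector"
  assumes p: "mono_on {..n} p" and q: "strict_mono_on {..N} q" and sub: "p ` {..n} \<subseteq> q ` {..N}"
  shows "step_integral W n p c \<omega> = (\<Sum>j<N. step_fun n p c (q (Suc j)) *\<^sub>R (W (q (Suc j)) \<omega> - W (q j) \<omega>))"
proof -
  have "(\<Sum>j<N. step_fun n p c (q (Suc j)) *\<^sub>R (W (q (Suc j)) \<omega> - W (q j) \<omega>))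
    = (\<Sum>i<n. c i *\<^sub>R (\<Sum>j<N. indicator {p i<..p (Suc i)} (q (Suc j)) *\<^sub>R (W (q (Suc j)) \<omega> - W (q j) \<omega>)))"
    unfolding step_fun_def scaleR_sum_left scaleR_sum_right by (subst sum.swap) simp
  also have "\<dots> = step_integral W n p c \<omega>"
    unfolding step_integral_def
  proof (rule sum.cong[OF refl])
    fix i assume "i \<in> {..<n}"
    then obtain a b where ab: "p i = q a" "p (Suc i) = q b" "a \<le> b" "b \<le> N"
      using mono_on_image_index[OF p q sub, of i] by auto
    show "c i *\<^sub>R (\<Sum>j<N. indicator {p i<..p (Suc i)} (q (Suc j)) *\<^sub>R (W (q (Suc j)) \<omega> - W (q j) \<omega>))
      = c i *\<^sub>R (W (p (Suc i)) \<omega> - W (p i) \<omega>)"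
      unfolding ab using sum_indicator_telescope[OF q ab(3,4), of "\<lambda>j. W (q j) \<omega>"] by simp
  qed
  finally show ?thesis by simp
qed

text \<open>All partition points are grid points, so none lies strictly inside a cell and every
  indicator is constant there.\<close>

lemma step_fun_refine:
  assumes p: "mono_on {..n} p" and q: "strict_mono_on {..N} q" and sub: "p ` {..n} \<subseteq> q ` {..N}"
    and j: "j < N" and s: "q j < s" "s \<le> q (Suc j)"
  shows "step_fun n p c s = step_fun n p c (q (Suc j))"
  unfolding step_fun_def
proof (rule sum.cong[OF refl])
  fix i assume "i \<in> {..<n}"
  then obtain a b where ab: "p i = q a" "p (Suc i) = q b" "a \<le> b" "b \<le> N"
    using mono_on_image_index[OF p q sub, of i] by auto
  have "q a < s \<longleftrightarrow> q a < q (Suc j)"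
    using s ab j strict_mono_on_less[OF q, of a "Suc j"] strict_mono_on_less_eq[OF q, of a j] by force
  moreover have "s \<le> q b \<longleftrightarrow> q (Suc j) \<le> q b"
    using s ab j strict_mono_on_less_eq[OF q, of "Suc j" b] strict_mono_on_less[OF q, of j b] by force
  ultimately show "c i * indicator {p i<..p (Suc i)} s = c i * indicator {p i<..p (Suc i)} (q (Suc j))"
    by (simp add: ab indicator_def)
qed

lemma ex_strict_mono_enumeration:
  fixes F :: "'a::linorder set"
  assumes "finite F" "F \<noteq> {}"
  obtains N and q :: "nat \<Rightarrow> 'a" where "strict_mono_on {..N} q" "q ` {..N} = F"
proof -
  define xs where "xs = sorted_list_of_set F"
  have xs: "set xs = F" "sorted xs" "distinct xs" "xs \<noteq> []"
    using assms by (auto simp: xs_def)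
  have len: "{..length xs - 1} = {..<length xs}" using xs(4) by (cases xs) auto
  have "strict_mono_on {..length xs - 1} (\<lambda>i. xs ! i)"
    unfolding len using xs by (auto simp: strict_mono_on_def strict_sorted_iff sorted_wrt_nth_less)
  moreover have "(\<lambda>i. xs ! i) ` {..length xs - 1} = F"
    unfolding len using xs(1) by (auto simp: in_set_conv_nth)
  ultimately show thesis by (rule that)
qed

text \<open>Discrete intermediate value argument: \<open>j\<close> is the first index from
  \<open>m\<close> on for which \<open>q (Suc j)\<close> reaches \<open>s\<close>.\<close>

lemma strict_mono_on_atMost_interval:
  fixes q :: "nat \<Rightarrow> real"
  assumes "q m < s" "s \<le> q N" "m \<le> N"
  obtains j where "m \<le> j" "j < N" "q j < s" "s \<le> q (Suc j)"
proof -
  define j where "j = (LEAST j. m \<le> j \<and> s \<le> q (Suc j))"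
  have "m < N" using assms by (cases "m = N") auto
  then have ex: "m \<le> N - 1 \<and> s \<le> q (Suc (N - 1))" using assms by auto
  have j: "m \<le> j \<and> s \<le> q (Suc j)" unfolding j_def by (rule LeastI) (rule ex)
  have "j \<le> N - 1" unfolding j_def by (rule Least_le) (rule ex)
  moreover have "q j < s"
  proof (rule ccontr)
    assume "\<not> q j < s"
    then have "m \<noteq> j" using assms by auto
    with \<open>\<not> q j < s\<close> j have "m \<le> j - 1 \<and> s \<le> q (Suc (j - 1))" by auto
    then have "j \<le> j - 1" unfolding j_def by (rule Least_le[folded j_def])
    with j \<open>m \<noteq> j\<close> show False by auto
  qed
  ultimately show thesis using j \<open>m < N\<close> by (intro that[of j]) auto
qed

text \<open>The sum on the right is the variance of the Gaussian sum in
  \<open>brownian_chain\<close>. In this direction the bound turns a lower bound for the L2 norm of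
  \<open>f\<close> into one for that variance.\<close>

lemma nn_integral_step_le:
  fixes f :: "real \<Rightarrow> real"
  assumes q: "strict_mono_on {..N} q" and mN: "m \<le> N"
    and f: "\<And>j s. j < N \<Longrightarrow> q j < s \<Longrightarrow> s \<le> q (Suc j) \<Longrightarrow> f s = f (q (Suc j))"
  shows "(\<integral>\<^sup>+s\<in>{q m<..<q N}. ennreal ((f s)\<^sup>2) \<partial>lborel)
    \<le> ennreal (\<Sum>j=m..<N. (f (q (Suc j)))\<^sup>2 * (q (Suc j) - q j))"
proof -
  have q': "q j < q (Suc j)" if "j < N" for j
    using that strict_mono_onD[OF q, of j "Suc j"] by auto
  have "(\<integral>\<^sup>+s\<in>{q m<..<q N}. ennreal ((f s)\<^sup>2) \<partial>lborel)
    \<le> (\<integral>\<^sup>+s. (\<Sum>j=m..<N. ennreal ((f (q (Suc j)))\<^sup>2) * indicator {q j<..q (Suc j)} s) \<partial>lborel)"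
  proof (rule nn_integral_mono)
    fix s :: real
    show "ennreal ((f s)\<^sup>2) * indicator {q m<..<q N} s
      \<le> (\<Sum>j=m..<N. ennreal ((f (q (Suc j)))\<^sup>2) * indicator {q j<..q (Suc j)} s)"
    proof (cases "s \<in> {q m<..<q N}")
      case True
      then obtain j where j: "m \<le> j" "j < N" "q j < s" "s \<le> q (Suc j)"
        using strict_mono_on_atMost_interval[of q m s N] mN by auto
      have "ennreal ((f s)\<^sup>2) * indicator {q m<..<q N} s = ennreal ((f (q (Suc j)))\<^sup>2) * indicator {q j<..q (Suc j)} s"
        using True j f[of j s] by simp
      also have "\<dots> \<le> (\<Sum>j=m..<N. ennreal ((f (q (Suc j)))\<^sup>2) * indicator {q j<..q (Suc j)} s)"
        using j by (intro member_le_sum) auto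
      finally show ?thesis .
    qed simp
  qed
  also have "\<dots> = (\<Sum>j=m..<N. ennreal ((f (q (Suc j)))\<^sup>2) * emeasure lborel {q j<..q (Suc j)})"
    by (subst nn_integral_sum) (auto simp: nn_integral_cmult_indicator)
  also have "\<dots> = (\<Sum>j=m..<N. ennreal ((f (q (Suc j)))\<^sup>2 * (q (Suc j) - q j)))"
    using q' by (intro sum.cong refl) (auto simp: ennreal_mult less_imp_le)
  also have "\<dots> = ennreal (\<Sum>j=m..<N. (f (q (Suc j)))\<^sup>2 * (q (Suc j) - q j))"
    using q' by (intro sum_ennreal) (auto simp: less_imp_le)
  finally show ?thesis .
qed

lemma step_integral_measurable:
  fixes W :: "real \<Rightarrow> 'w \<Rightarrow> real ^ 'd"
  assumes filt: "filtration_upto M T \<A>" and bm: "brownian_motion M T \<A> W"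
    and p: "p ` {..n} \<subseteq> {0..u}" and u: "u \<le> T"
  shows "step_integral W n p c \<in> borel_measurable (\<A> u)"
proof -
  have "W (p i) \<in> borel_measurable (\<A> u)" if "i \<le> n" for i
  proof -
    have "p i \<in> {0..u}" using p that by auto
    with bm u show ?thesis
      by (intro measurable_filtration[OF filt, of "p i" u]) (auto simp: brownian_motion_def adapted_upto_def)
  qed
  then show ?thesis
    unfolding step_integral_def[abs_def]
    by (intro borel_measurable_sum borel_measurable_scaleR borel_measurable_const borel_measurable_diff) auto
qed

section \<open>The kernel near the diagonal\<close>

lemma abs_pochhammer_le:
  fixes a c :: real
  assumes "\<bar>a\<bar> \<le> c"
  shows "\<bar>pochhammer a n\<bar> \<le> pochhammer c n"
  unfolding pochhammer_prod abs_prod using assms by (intro prod_mono) auto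

text \<open>In the coefficient, \<open>a\<close> is paired with \<open>c\<close> and
  \<open>b\<close> with 1, since \<open>n!\<close> is \<open>pochhammer 1 n\<close>. The kernel
  parameters \<open>h - 1/2\<close>, \<open>1/2 - h\<close>, \<open>h + 1/2\<close> meet the
  hypotheses.\<close>

lemma norm_fps_hypergeo_2_1_le:
  fixes a b c :: real
  assumes "\<bar>a\<bar> \<le> c" "\<bar>b\<bar> \<le> 1" "0 < c"
  shows "norm (fps_nth (fps_hypergeo [complex_of_real a, of_real b] [of_real c] 1) n) \<le> 1"
proof -
  have "\<bar>pochhammer a n\<bar> * \<bar>pochhammer b n\<bar> \<le> pochhammer c n * pochhammer 1 n"
    using assms by (intro mult_mono abs_pochhammer_le) (auto intro: pochhammer_nonneg)
  moreover have "0 < pochhammer c n" using assms by (intro pochhammer_pos)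
  ultimately show ?thesis
    by (simp add: norm_mult norm_divide pochhammer_of_real pochhammer_fact[symmetric] divide_le_eq_1)
qed

text \<open>Near 0 the function is its power series. Bounded coefficients give a positive radius of
  convergence, hence continuity at 0, where the constant term is 1.\<close>

lemma tendsto_gauss_hypergeo_0:
  fixes a b c :: real
  assumes "\<bar>a\<bar> \<le> c" "\<bar>b\<bar> \<le> 1" "0 < c"
  shows "gauss_hypergeo (of_real a) (of_real b) (of_real c) \<midarrow>0\<rightarrow> 1"
proof -
  let ?f = "fps_hypergeo [complex_of_real a, of_real b] [of_real c] 1"
  have "summable (\<lambda>n. fps_nth ?f n * (1/2) ^ n)"
  proof (rule summable_comparison_test'[of "\<lambda>n. (1/2) ^ n :: real"])
    show "norm (fps_nth ?f n * (1/2) ^ n) \<le> (1/2) ^ n" for n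
      using mult_right_mono[OF norm_fps_hypergeo_2_1_le[OF assms, of n], of "(1/2) ^ n"]
      by (simp add: norm_mult norm_power norm_divide del: fps_hypergeo_nth)
  qed simp
  from conv_radius_geI[OF this] have "0 < fps_conv_radius ?f"
    unfolding fps_conv_radius_def by (rule less_le_trans[rotated]) simp
  then have "isCont (eval_fps ?f) 0"
    by (intro continuous_eval_fps) (simp add: zero_ereal_def)
  then have "eval_fps ?f \<midarrow>0\<rightarrow> 1"
    by (simp add: isCont_def eval_fps_at_0 del: fps_hypergeo_nth)
  moreover have "\<forall>\<^sub>F z in at 0. eval_fps ?f z = gauss_hypergeo (of_real a) (of_real b) (of_real c) z"
    unfolding eventually_at by (intro exI[of _ 1]) (auto simp: gauss_hypergeo_def)
  ultimately show ?thesis by (rule Lim_transform_eventually)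
qed

text \<open>As \<open>s\<close> increases to \<open>t\<close>, the argument \<open>1 - t / s\<close>
  tends to 0 through negative values, so the hypergeometric factor tends to 1.\<close>

lemma fbm_kernel_asymp:
  fixes h t :: real
  assumes h: "0 < h" "h < 1" and t: "0 < t"
  shows "((\<lambda>s. fbm_kernel h t s / (t - s) powr (h - 1/2)) \<longlongrightarrow> 1 / Gamma (h + 1/2)) (at_left t)"
proof -
  define F where "F s = Re (gauss_hypergeo (of_real (h - 1/2)) (of_real (1/2 - h)) (of_real (h + 1/2))
    (of_real (1 - t / s)))" for s
  have "filterlim (\<lambda>s. complex_of_real (1 - t / s)) (at 0) (at_left t)"
    unfolding filterlim_at
  proof
    have "((\<lambda>s. complex_of_real (1 - t / s)) \<longlongrightarrow> of_real (1 - t / t)) (at_left t)"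
      by (intro tendsto_intros) (use t in auto)
    then show "((\<lambda>s. complex_of_real (1 - t / s)) \<longlongrightarrow> 0) (at_left t)" using t by simp
    have "\<forall>\<^sub>F s in at_left t. s \<in> {0<..<t}"
      using t by (intro eventually_at_leftI[of 0]) auto
    then show "\<forall>\<^sub>F s in at_left t. complex_of_real (1 - t / s) \<in> UNIV \<and> complex_of_real (1 - t / s) \<noteq> 0"
      by eventually_elim (auto simp flip: of_real_diff of_real_divide)
  qed
  then have "(F \<longlongrightarrow> Re 1) (at_left t)"
    unfolding F_def
    by (intro tendsto_Re filterlim_compose[OF tendsto_gauss_hypergeo_0]) (use h in \<open>auto simp: abs_if\<close>)
  then have "((\<lambda>s. 1 / Gamma (h + 1/2) * F s) \<longlongrightarrow> 1 / Gamma (h + 1/2) * 1) (at_left t)"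
    by (intro tendsto_mult tendsto_const) simp
  moreover have "\<forall>\<^sub>F s in at_left t. 1 / Gamma (h + 1/2) * F s = fbm_kernel h t s / (t - s) powr (h - 1/2)"
  proof -
    have "\<forall>\<^sub>F s in at_left t. s \<in> {0<..<t}"
      using t by (intro eventually_at_leftI[of 0]) auto
    then show ?thesis by eventually_elim (simp add: fbm_kernel_def F_def)
  qed
  ultimately show ?thesis
    by (simp add: tendsto_cong)
qed

text \<open>The summand with the smaller Hurst index is the more singular one at the diagonal, so the two
  kernels cannot cancel there.\<close>

lemma mixed_kernel_lower_bound:
  fixes h1 h2 t a1 a2 :: real
  assumes h: "0 < h1" "h1 < h2" "h2 < 1" and t: "0 < t" and a1: "a1 \<noteq> 0"
  obtains c e where "0 < c" "0 < e" "e < t"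
    "\<And>s. t - e < s \<Longrightarrow> s < t \<Longrightarrow>
       c * (t - s) powr (h1 - 1/2) \<le> \<bar>a1 * fbm_kernel h1 t s + a2 * fbm_kernel h2 t s\<bar>"
proof -
  let ?R = "\<lambda>s. (a1 * fbm_kernel h1 t s + a2 * fbm_kernel h2 t s) / (t - s) powr (h1 - 1/2)"
  have pos: "\<forall>\<^sub>F s in at_left t. s \<in> {0<..<t}"
    using t by (intro eventually_at_leftI[of 0]) auto
  have "((\<lambda>s. t - s) \<longlongrightarrow> t - t) (at_left t)" by (intro tendsto_intros)
  then have "((\<lambda>s. (t - s) powr (h2 - h1)) \<longlongrightarrow> 0) (at_left t)"
    using h pos by (intro tendsto_zero_powrI[where b="h2 - h1"]) (auto elim: eventually_mono)
  \<comment> \<open>Measured on the scale of the first kernel, the second one carries the extra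
    factor \<open>(t - s) powr (h2 - h1)\<close>, which vanishes in the limit.\<close>
  then have "((\<lambda>s. a1 * (fbm_kernel h1 t s / (t - s) powr (h1 - 1/2))
      + a2 * ((fbm_kernel h2 t s / (t - s) powr (h2 - 1/2)) * (t - s) powr (h2 - h1)))
    \<longlongrightarrow> a1 * (1 / Gamma (h1 + 1/2)) + a2 * (1 / Gamma (h2 + 1/2) * 0)) (at_left t)"
    using h t by (intro tendsto_intros fbm_kernel_asymp) auto
  moreover have "\<forall>\<^sub>F s in at_left t. a1 * (fbm_kernel h1 t s / (t - s) powr (h1 - 1/2))
      + a2 * ((fbm_kernel h2 t s / (t - s) powr (h2 - 1/2)) * (t - s) powr (h2 - h1)) = ?R s"
    using pos
  proof eventually_elim
    case (elim s)
    have "(t - s) powr (h2 - 1/2) = (t - s) powr (h2 - h1) * (t - s) powr (h1 - 1/2)"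
      by (simp flip: powr_add)
    then show ?case using elim by (simp add: add_divide_distrib)
  qed
  ultimately have "(?R \<longlongrightarrow> a1 * (1 / Gamma (h1 + 1/2))) (at_left t)"
    by (simp add: tendsto_cong)
  then have lim: "((\<lambda>s. \<bar>?R s\<bar>) \<longlongrightarrow> \<bar>a1 * (1 / Gamma (h1 + 1/2))\<bar>) (at_left t)"
    by (rule tendsto_rabs)
  \<comment> \<open>Half the limit of the normalised kernel, so that the kernel stays above it close
    to \<open>t\<close>.\<close>
  define c where "c = \<bar>a1 * (1 / Gamma (h1 + 1/2))\<bar> / 2"
  have "0 < Gamma (h1 + 1/2)" using h by (intro Gamma_real_pos) auto
  then have c: "0 < c" using a1 by (simp add: c_def)
  then have "\<forall>\<^sub>F s in at_left t. c < \<bar>?R s\<bar>"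
    using order_tendstoD(1)[OF lim, of c] by (simp add: c_def)
  then obtain b where b: "b < t" "\<And>s. b < s \<Longrightarrow> s < t \<Longrightarrow> c < \<bar>?R s\<bar>"
    unfolding eventually_at_left_field by auto
  show thesis
  \<comment> \<open>The minimum with \<open>t / 2\<close> keeps the window inside the positive
    times.\<close>
  proof (rule that[of c "min (t - b) (t / 2)"])
    fix s assume s: "t - min (t - b) (t / 2) < s" "s < t"
    then have "c < \<bar>?R s\<bar>" by (intro b) auto
    then show "c * (t - s) powr (h1 - 1/2) \<le> \<bar>a1 * fbm_kernel h1 t s + a2 * fbm_kernel h2 t s\<bar>"
      using s by (simp add: field_simps)
  qed (use b c t in auto)
qed

text \<open>Only the half of the interval adjacent to \<open>u\<close> is used. There
  \<open>t - s\<close> lies between half the length and the full length, so its power is at least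
  half the power of the length, whatever the sign of the exponent \<open>2 * h - 1\<close>. The two
  halves make the factor 1/4.\<close>

lemma nn_integral_power_lower_bound:
  fixes k :: "real \<Rightarrow> real"
  assumes h: "0 < h" "h < 1" and c: "0 \<le> c" and ut: "u < t"
    and k: "\<And>s. u < s \<Longrightarrow> s < t \<Longrightarrow> c * (t - s) powr (h - 1/2) \<le> \<bar>k s\<bar>"
  shows "ennreal (c\<^sup>2 * (t - u) powr (2 * h) / 4) \<le> (\<integral>\<^sup>+s\<in>{u<..<t}. ennreal ((k s)\<^sup>2) \<partial>lborel)"
proof -
  define \<epsilon> where "\<epsilon> = t - u"
  have \<epsilon>: "0 < \<epsilon>" using ut by (simp add: \<epsilon>_def)
  have *: "c\<^sup>2 * (\<epsilon> powr (2 * h - 1) / 2) \<le> (k s)\<^sup>2" if s: "u < s" "s < u + \<epsilon> / 2" for s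
  proof -
    have r: "\<epsilon> / 2 \<le> t - s" "t - s \<le> \<epsilon>" "0 < t - s" "s < t" using s \<epsilon> by (auto simp: \<epsilon>_def field_simps)
    have "\<epsilon> powr (2 * h - 1) / 2 \<le> (t - s) powr (2 * h - 1)"
    proof (cases "1 \<le> 2 * h")
      case True
      have "\<epsilon> powr (2 * h - 1) / 2 \<le> \<epsilon> powr (2 * h - 1) / 2 powr (2 * h - 1)"
        using powr_mono[of "2 * h - 1" 1 2] h by (intro divide_left_mono) auto
      also have "\<dots> = (\<epsilon> / 2) powr (2 * h - 1)" using \<epsilon> by (simp add: powr_divide)
      also have "\<dots> \<le> (t - s) powr (2 * h - 1)" using r \<epsilon> True by (intro powr_mono2) auto
      finally show ?thesis .
    next
      case False
      have "\<epsilon> powr (2 * h - 1) \<le> (t - s) powr (2 * h - 1)" using r False by (intro powr_mono2') auto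
      moreover have "0 \<le> \<epsilon> powr (2 * h - 1)" by simp
      ultimately show ?thesis by linarith
    qed
    then have "c\<^sup>2 * (\<epsilon> powr (2 * h - 1) / 2) \<le> c\<^sup>2 * (t - s) powr (2 * h - 1)"
      by (intro mult_left_mono) auto
    also have "(t - s) powr (2 * h - 1) = ((t - s) powr (h - 1/2))\<^sup>2"
      using r by (simp add: power2_eq_square flip: powr_add)
    also have "c\<^sup>2 * ((t - s) powr (h - 1/2))\<^sup>2 = (c * (t - s) powr (h - 1/2))\<^sup>2"
      by (simp add: power_mult_distrib)
    also have "\<dots> \<le> \<bar>k s\<bar>\<^sup>2" using k[of s] s r c by (intro power_mono) auto
    finally show ?thesis by simp
  qed
  have eq: "c\<^sup>2 * (t - u) powr (2 * h) / 4 = c\<^sup>2 * (\<epsilon> powr (2 * h - 1) / 2) * (\<epsilon> / 2)"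
    using \<epsilon> powr_add[of \<epsilon> "2 * h - 1" 1] by (simp add: \<epsilon>_def)
  have "ennreal (c\<^sup>2 * (t - u) powr (2 * h) / 4) = ennreal (c\<^sup>2 * (\<epsilon> powr (2 * h - 1) / 2)) * ennreal (\<epsilon> / 2)"
    unfolding eq using \<epsilon> by (intro ennreal_mult) auto
  also have "\<dots> = (\<integral>\<^sup>+s\<in>{u<..<u + \<epsilon> / 2}. ennreal (c\<^sup>2 * (\<epsilon> powr (2 * h - 1) / 2)) \<partial>lborel)"
    using \<epsilon> by (simp add: nn_integral_cmult_indicator)
  also have "\<dots> \<le> (\<integral>\<^sup>+s\<in>{u<..<t}. ennreal ((k s)\<^sup>2) \<partial>lborel)"
  proof -
    have "u + \<epsilon> / 2 < t" using ut by (simp add: \<epsilon>_def field_simps)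
    with * show ?thesis
      by (intro nn_integral_mono) (auto split: split_indicator intro!: ennreal_leI)
  qed
  finally show ?thesis .
qed

section \<open>Increments of the mixed noise\<close>

lemma has_wiener_integralD:
  assumes "has_wiener_integral M W t f Y"
  shows "Y \<in> borel_measurable M" "set_borel_measurable borel {0<..<t} f"
  using assms unfolding has_wiener_integral_def by blast+

lemma wiener_integral_approx:
  fixes W :: "real \<Rightarrow> 'w \<Rightarrow> real ^ 'd"
  assumes M: "prob_space M" and filt: "filtration_upto M T \<A>" and bm: "brownian_motion M T \<A> W"
    and t: "0 \<le> t" "t \<le> T" and wi: "has_wiener_integral M W t f Y" and \<eta>: "0 < \<eta>" "0 < \<gamma>"
  obtains n p c where "mono_on {..n} p" "p ` {..n} \<subseteq> {0..t}"
    "(\<integral>\<^sup>+s\<in>{0<..<t}. ennreal ((f s - step_fun n p c s)\<^sup>2) \<partial>lborel) \<le> ennreal \<gamma>"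
    "(\<integral>\<^sup>+\<omega>. ennreal (norm (Y \<omega> - step_integral W n p c \<omega>)) \<partial>M) \<le> ennreal \<eta>"
proof -
  interpret prob_space M by fact
  have [measurable]: "Y \<in> borel_measurable M" using wi by (simp add: has_wiener_integral_def)
  from wi obtain n p c where npc: "\<And>k::nat. mono_on {..n k} (p k)" "\<And>k. p k ` {..n k} \<subseteq> {0..t}"
    and lim1: "(\<lambda>k. \<integral>\<^sup>+s\<in>{0<..<t}. ennreal ((f s - step_fun (n k) (p k) (c k) s)\<^sup>2) \<partial>lborel) \<longlonglongrightarrow> 0"
    and lim2: "(\<lambda>k. \<integral>\<^sup>+\<omega>. ennreal ((norm (Y \<omega> - step_integral W (n k) (p k) (c k) \<omega>))\<^sup>2) \<partial>M) \<longlonglongrightarrow> 0"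
    unfolding has_wiener_integral_def by blast
  have "\<forall>\<^sub>F k in sequentially.
      (\<integral>\<^sup>+s\<in>{0<..<t}. ennreal ((f s - step_fun (n k) (p k) (c k) s)\<^sup>2) \<partial>lborel) < ennreal \<gamma> \<and>
      (\<integral>\<^sup>+\<omega>. ennreal ((norm (Y \<omega> - step_integral W (n k) (p k) (c k) \<omega>))\<^sup>2) \<partial>M) < ennreal (\<eta>\<^sup>2)"
    using \<eta> by (intro eventually_conj order_tendstoD(2)[OF lim1] order_tendstoD(2)[OF lim2]) auto
  then obtain k where k1: "(\<integral>\<^sup>+s\<in>{0<..<t}. ennreal ((f s - step_fun (n k) (p k) (c k) s)\<^sup>2) \<partial>lborel) < ennreal \<gamma>"
    and k2: "(\<integral>\<^sup>+\<omega>. ennreal ((norm (Y \<omega> - step_integral W (n k) (p k) (c k) \<omega>))\<^sup>2) \<partial>M) < ennreal (\<eta>\<^sup>2)"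
    by (auto dest: eventually_happens)
  have "subalgebra M (\<A> t)" using filt t unfolding filtration_upto_def by auto
  from measurable_from_subalg[OF this step_integral_measurable[OF filt bm npc(2) t(2)]]
  have [measurable]: "step_integral W (n k) (p k) (c k) \<in> borel_measurable M" .
  define r where "r \<omega> = norm (Y \<omega> - step_integral W (n k) (p k) (c k) \<omega>)" for \<omega>
  have [measurable]: "r \<in> borel_measurable M" unfolding r_def by measurable
  \<comment> \<open>The passage from L2 to L1 uses the pointwise bound
    \<open>r \<le> \<eta> / 2 + r\<^sup>2 / (2 * \<eta>)\<close>; a mean square below
    \<open>\<eta>\<^sup>2\<close> then gives a mean of at most \<open>\<eta>\<close>.\<close>
  have "(\<integral>\<^sup>+\<omega>. ennreal (r \<omega>) \<partial>M) \<le> (\<integral>\<^sup>+\<omega>. ennreal (\<eta> / 2) + ennreal (1 / (2 * \<eta>)) * ennreal ((r \<omega>)\<^sup>2) \<partial>M)"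
  proof (rule nn_integral_mono)
    fix \<omega>
    have "0 \<le> (r \<omega> - \<eta>)\<^sup>2" by simp
    then have "r \<omega> \<le> \<eta> / 2 + 1 / (2 * \<eta>) * (r \<omega>)\<^sup>2"
      using \<eta> by (simp add: power2_eq_square field_simps)
    then show "ennreal (r \<omega>) \<le> ennreal (\<eta> / 2) + ennreal (1 / (2 * \<eta>)) * ennreal ((r \<omega>)\<^sup>2)"
      using \<eta> by (simp flip: ennreal_mult ennreal_plus add: ennreal_leI)
  qed
  also have "\<dots> = ennreal (\<eta> / 2) + ennreal (1 / (2 * \<eta>)) * (\<integral>\<^sup>+\<omega>. ennreal ((r \<omega>)\<^sup>2) \<partial>M)"
    by (simp add: nn_integral_add nn_integral_cmult emeasure_space_1)
  also have "\<dots> \<le> ennreal (\<eta> / 2) + ennreal (1 / (2 * \<eta>)) * ennreal (\<eta>\<^sup>2)"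
    using k2 by (intro add_left_mono mult_left_mono) (auto simp: r_def less_imp_le)
  also have "\<dots> = ennreal \<eta>"
    using \<eta> by (simp flip: ennreal_mult ennreal_plus add: power2_eq_square)
  finally show thesis
    using that[OF npc k1[THEN less_imp_le]] by (simp add: r_def)
qed

lemma step_fun_measurable [measurable]: "step_fun n p c \<in> borel_measurable borel"
  unfolding step_fun_def[abs_def] by measurable

text \<open>The mixed kernel is the mixed step function plus two approximation errors. Applying
  \<open>(x + y)\<^sup>2 \<le> 2 * x\<^sup>2 + 2 * y\<^sup>2\<close> twice produces the constants 2,
  4 and 4.\<close>

lemma nn_integral_mixed_le:
  fixes k1 k2 f1 f2 :: "real \<Rightarrow> real"
  assumes k: "set_borel_measurable borel {0<..<t} k1" "set_borel_measurable borel {0<..<t} k2"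
    and [measurable]: "f1 \<in> borel_measurable borel" "f2 \<in> borel_measurable borel" and u: "0 \<le> u"
  shows "(\<integral>\<^sup>+s\<in>{u<..<t}. ennreal ((a1 * k1 s + a2 * k2 s)\<^sup>2) \<partial>lborel)
    \<le> 2 * (\<integral>\<^sup>+s\<in>{u<..<t}. ennreal ((a1 * f1 s + a2 * f2 s)\<^sup>2) \<partial>lborel)
      + ennreal (4 * a1\<^sup>2) * (\<integral>\<^sup>+s\<in>{0<..<t}. ennreal ((k1 s - f1 s)\<^sup>2) \<partial>lborel)
      + ennreal (4 * a2\<^sup>2) * (\<integral>\<^sup>+s\<in>{0<..<t}. ennreal ((k2 s - f2 s)\<^sup>2) \<partial>lborel)"
proof -
  \<comment> \<open>The kernels are measurable only on \<open>{0<..<t}\<close>; multiplying by this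
    indicator makes them measurable everywhere without changing the integrals.\<close>
  define I :: "real \<Rightarrow> real" where "I = indicator {0<..<t}"
  have [measurable]: "(\<lambda>s. I s * k1 s) \<in> borel_measurable borel" "(\<lambda>s. I s * k2 s) \<in> borel_measurable borel"
    using k by (auto simp: set_borel_measurable_def I_def)
  have [measurable]: "I \<in> borel_measurable borel" by (simp add: I_def)
  have cong: "(\<integral>\<^sup>+s\<in>{0<..<t}. ennreal ((I s * k s - f s)\<^sup>2) \<partial>lborel) = (\<integral>\<^sup>+s\<in>{0<..<t}. ennreal ((k s - f s)\<^sup>2) \<partial>lborel)"
    for k f :: "real \<Rightarrow> real"
    by (intro nn_integral_cong) (auto simp: I_def split: split_indicator)
  have "(\<integral>\<^sup>+s\<in>{u<..<t}. ennreal ((a1 * k1 s + a2 * k2 s)\<^sup>2) \<partial>lborel)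
    \<le> (\<integral>\<^sup>+s. 2 * (ennreal ((a1 * f1 s + a2 * f2 s)\<^sup>2) * indicator {u<..<t} s)
        + ennreal (4 * a1\<^sup>2) * (ennreal ((I s * k1 s - f1 s)\<^sup>2) * indicator {0<..<t} s)
        + ennreal (4 * a2\<^sup>2) * (ennreal ((I s * k2 s - f2 s)\<^sup>2) * indicator {0<..<t} s) \<partial>lborel)"
  proof (rule nn_integral_mono)
    fix s :: real
    have sq: "(x + y)\<^sup>2 \<le> 2 * x\<^sup>2 + 2 * y\<^sup>2" for x y :: real
      using sum_squares_bound[of x y] by (simp add: power2_sum)
    define f where "f = a1 * f1 s + a2 * f2 s"
    define x where "x = a1 * (k1 s - f1 s)"
    define y where "y = a2 * (k2 s - f2 s)"
    have "(f + (x + y))\<^sup>2 \<le> 2 * f\<^sup>2 + 2 * (2 * x\<^sup>2 + 2 * y\<^sup>2)"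
      by (rule order_trans[OF sq]) (use sq[of x y] in simp)
    then have "(a1 * k1 s + a2 * k2 s)\<^sup>2 \<le> 2 * f\<^sup>2 + 4 * a1\<^sup>2 * (k1 s - f1 s)\<^sup>2 + 4 * a2\<^sup>2 * (k2 s - f2 s)\<^sup>2"
    proof -
      have "f + (x + y) = a1 * k1 s + a2 * k2 s" by (simp add: x_def y_def f_def algebra_simps)
      moreover have "x\<^sup>2 = a1\<^sup>2 * (k1 s - f1 s)\<^sup>2" "y\<^sup>2 = a2\<^sup>2 * (k2 s - f2 s)\<^sup>2"
        by (simp_all add: x_def y_def power_mult_distrib)
      ultimately show ?thesis
        using \<open>(f + (x + y))\<^sup>2 \<le> 2 * f\<^sup>2 + 2 * (2 * x\<^sup>2 + 2 * y\<^sup>2)\<close> by simp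
    qed
    then have "ennreal ((a1 * k1 s + a2 * k2 s)\<^sup>2)
      \<le> ennreal 2 * ennreal (f\<^sup>2) + ennreal (4 * a1\<^sup>2) * ennreal ((k1 s - f1 s)\<^sup>2) + ennreal (4 * a2\<^sup>2) * ennreal ((k2 s - f2 s)\<^sup>2)"
    proof -
      assume "(a1 * k1 s + a2 * k2 s)\<^sup>2 \<le> 2 * f\<^sup>2 + 4 * a1\<^sup>2 * (k1 s - f1 s)\<^sup>2 + 4 * a2\<^sup>2 * (k2 s - f2 s)\<^sup>2"
      from ennreal_leI[OF this] show ?thesis by (simp add: ennreal_mult)
    qed
    then show "ennreal ((a1 * k1 s + a2 * k2 s)\<^sup>2) * indicator {u<..<t} s
      \<le> 2 * (ennreal ((a1 * f1 s + a2 * f2 s)\<^sup>2) * indicator {u<..<t} s)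
        + ennreal (4 * a1\<^sup>2) * (ennreal ((I s * k1 s - f1 s)\<^sup>2) * indicator {0<..<t} s)
        + ennreal (4 * a2\<^sup>2) * (ennreal ((I s * k2 s - f2 s)\<^sup>2) * indicator {0<..<t} s)"
      using u by (simp add: f_def I_def split: split_indicator)
  qed
  also have "\<dots> = 2 * (\<integral>\<^sup>+s\<in>{u<..<t}. ennreal ((a1 * f1 s + a2 * f2 s)\<^sup>2) \<partial>lborel)
      + ennreal (4 * a1\<^sup>2) * (\<integral>\<^sup>+s\<in>{0<..<t}. ennreal ((I s * k1 s - f1 s)\<^sup>2) \<partial>lborel)
      + ennreal (4 * a2\<^sup>2) * (\<integral>\<^sup>+s\<in>{0<..<t}. ennreal ((I s * k2 s - f2 s)\<^sup>2) \<partial>lborel)"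
    by (simp add: nn_integral_add nn_integral_cmult)
  finally show ?thesis unfolding cong .
qed

text \<open>Approximating by step functions on a common grid containing \<^term>\<open>u\<close> splits the increment of the
  mixed noise over \<^term>\<open>{u..t}\<close> into a past part and a Gaussian innovation, without using
  convergence of the two parts.\<close>

lemma mixed_increment_approx:
  fixes W :: "real \<Rightarrow> 'w \<Rightarrow> real ^ 'd"
  assumes M: "prob_space M" and filt: "filtration_upto M T \<A>" and bm: "brownian_motion M T \<A> W"
    and ut: "0 \<le> u" "u < t" "t \<le> T"
    and wi: "has_wiener_integral M W t k1 Y1" "has_wiener_integral M W t k2 Y2"
      "has_wiener_integral M W u l1 Z1" "has_wiener_integral M W u l2 Z2"
    and \<beta>: "0 < \<beta>" "ennreal \<beta> \<le> (\<integral>\<^sup>+s\<in>{u<..<t}. ennreal ((a1 * k1 s + a2 * k2 s)\<^sup>2) \<partial>lborel)"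
    and \<kappa>: "0 < \<kappa>"
  obtains \<sigma> V G where "sqrt \<beta> / 2 \<le> \<sigma>" "V \<in> borel_measurable (\<A> u)" "G \<in> borel_measurable M"
    "(\<integral>\<^sup>+\<omega>. ennreal (norm ((a1 *\<^sub>R Y1 \<omega> + a2 *\<^sub>R Y2 \<omega>) - (a1 *\<^sub>R Z1 \<omega> + a2 *\<^sub>R Z2 \<omega>) - (V \<omega> + G \<omega>))) \<partial>M) \<le> ennreal \<kappa>"
    "\<And>Y \<phi>. Y \<in> borel_measurable (\<A> u) \<Longrightarrow> unit_valued \<phi> \<Longrightarrow>
      (LINT \<omega>|M. \<phi> (Y \<omega> + G \<omega>)) = (LINT \<omega>|M. smooth \<sigma> \<phi> (Y \<omega>))"
proof -
  interpret prob_space M by fact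
  have t0: "0 \<le> t" and uT: "u \<le> T" using ut by auto
  \<comment> \<open>The four step approximations enter with weights \<open>a1\<close>,
    \<open>a2\<close>, \<open>a1\<close>, \<open>a2\<close>, so their L1 errors add up to
    \<open>2 * (\<bar>a1\<bar> + \<bar>a2\<bar>) * \<eta>\<close>. The constant 1 in this
    denominator and the next keeps it positive.\<close>
  define \<eta> where "\<eta> = \<kappa> / (2 * (\<bar>a1\<bar> + \<bar>a2\<bar>) + 1)"
  \<comment> \<open>Makes the two error terms of \<open>nn_integral_mixed_le\<close> together at
    most \<open>\<beta> / 2\<close>.\<close>
  define \<gamma> where "\<gamma> = \<beta> / (8 * (a1\<^sup>2 + a2\<^sup>2) + 1)"
  have den: "0 < 2 * (\<bar>a1\<bar> + \<bar>a2\<bar>) + 1" "0 < 8 * (a1\<^sup>2 + a2\<^sup>2) + 1"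
    by (simp_all add: add_nonneg_pos)
  have \<eta>: "0 < \<eta>" "2 * (\<bar>a1\<bar> + \<bar>a2\<bar>) * \<eta> \<le> \<kappa>"
    using \<kappa> den by (auto simp: \<eta>_def field_simps)
  have "\<gamma> * (8 * (a1\<^sup>2 + a2\<^sup>2) + 1) = \<beta>" "0 < \<gamma>"
    using \<beta> den by (auto simp: \<gamma>_def)
  then have \<gamma>: "0 < \<gamma>" "4 * a1\<^sup>2 * \<gamma> + 4 * a2\<^sup>2 * \<gamma> \<le> \<beta> / 2"
    by (auto simp: algebra_simps)
  obtain n1 p1 c1 where 1: "mono_on {..n1} p1" "p1 ` {..n1} \<subseteq> {0..t}"
    "(\<integral>\<^sup>+s\<in>{0<..<t}. ennreal ((k1 s - step_fun n1 p1 c1 s)\<^sup>2) \<partial>lborel) \<le> ennreal \<gamma>"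
    "(\<integral>\<^sup>+\<omega>. ennreal (norm (Y1 \<omega> - step_integral W n1 p1 c1 \<omega>)) \<partial>M) \<le> ennreal \<eta>"
    by (rule wiener_integral_approx[OF M filt bm t0 ut(3) wi(1) \<eta>(1) \<gamma>(1)])
  obtain n2 p2 c2 where 2: "mono_on {..n2} p2" "p2 ` {..n2} \<subseteq> {0..t}"
    "(\<integral>\<^sup>+s\<in>{0<..<t}. ennreal ((k2 s - step_fun n2 p2 c2 s)\<^sup>2) \<partial>lborel) \<le> ennreal \<gamma>"
    "(\<integral>\<^sup>+\<omega>. ennreal (norm (Y2 \<omega> - step_integral W n2 p2 c2 \<omega>)) \<partial>M) \<le> ennreal \<eta>"
    by (rule wiener_integral_approx[OF M filt bm t0 ut(3) wi(2) \<eta>(1) \<gamma>(1)])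
  obtain n3 p3 c3 where 3: "mono_on {..n3} p3" "p3 ` {..n3} \<subseteq> {0..u}"
    "(\<integral>\<^sup>+s\<in>{0<..<u}. ennreal ((l1 s - step_fun n3 p3 c3 s)\<^sup>2) \<partial>lborel) \<le> ennreal \<gamma>"
    "(\<integral>\<^sup>+\<omega>. ennreal (norm (Z1 \<omega> - step_integral W n3 p3 c3 \<omega>)) \<partial>M) \<le> ennreal \<eta>"
    by (rule wiener_integral_approx[OF M filt bm ut(1) uT wi(3) \<eta>(1) \<gamma>(1)])
  obtain n4 p4 c4 where 4: "mono_on {..n4} p4" "p4 ` {..n4} \<subseteq> {0..u}"
    "(\<integral>\<^sup>+s\<in>{0<..<u}. ennreal ((l2 s - step_fun n4 p4 c4 s)\<^sup>2) \<partial>lborel) \<le> ennreal \<gamma>"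
    "(\<integral>\<^sup>+\<omega>. ennreal (norm (Z2 \<omega> - step_integral W n4 p4 c4 \<omega>)) \<partial>M) \<le> ennreal \<eta>"
    by (rule wiener_integral_approx[OF M filt bm ut(1) uT wi(4) \<eta>(1) \<gamma>(1)])
  \<comment> \<open>The grid contains \<open>u\<close>, so that no cell straddles the splitting
    time, and \<open>t\<close>, which becomes its last point. The partitions for time
    \<open>u\<close> stay outside it, since their step integrals enter the past part as a
    whole.\<close>
  obtain N and q :: "nat \<Rightarrow> real" where q: "strict_mono_on {..N} q"
    and im: "q ` {..N} = insert u (insert t (p1 ` {..n1} \<union> p2 ` {..n2}))"
    by (rule ex_strict_mono_enumeration[of "insert u (insert t (p1 ` {..n1} \<union> p2 ` {..n2}))"]) auto
  have "q ` {..N} \<subseteq> {0..t}"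
    unfolding im using 1(2) 2(2) ut by auto
  then have q_mem: "q i \<in> {0..t}" if "i \<le> N" for i
    using that by auto
  have q_Suc: "q i < q (Suc i)" if "i < N" for i
    using that strict_mono_onD[OF q, of i "Suc i"] by auto
  obtain m where m: "m \<le> N" "q m = u"
    using im by (metis atMost_iff imageE insertI1)
  obtain i where i: "i \<le> N" "q i = t"
    using im by (metis atMost_iff imageE insertI1 insertI2)
  have qN: "q N = t"
    using i q_mem[of N] strict_mono_on_less_eq[OF q, of i N] by auto
  have sub: "p1 ` {..n1} \<subseteq> q ` {..N}" "p2 ` {..n2} \<subseteq> q ` {..N}" using im by auto
  define f where "f s = a1 * step_fun n1 p1 c1 s + a2 * step_fun n2 p2 c2 s" for s
  define D where "D j \<omega> = f (q (Suc j)) *\<^sub>R (W (q (Suc j)) \<omega> - W (q j) \<omega>)" for j \<omega>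
  define G where "G \<omega> = (\<Sum>j=m..<N. D j \<omega>)" for \<omega>
  \<comment> \<open>Increments before \<open>u\<close> do not cancel here: the kernels for
    \<open>t\<close> and for \<open>u\<close> differ on the past. Whatever remains is known at time
    \<open>u\<close>.\<close>
  define V where "V \<omega> = (\<Sum>j<m. D j \<omega>)
    - (a1 *\<^sub>R step_integral W n3 p3 c3 \<omega> + a2 *\<^sub>R step_integral W n4 p4 c4 \<omega>)" for \<omega>
  define \<Sigma> where "\<Sigma> = (\<Sum>j=m..<N. (f (q (Suc j)))\<^sup>2 * (q (Suc j) - q j))"
  have \<Sigma>0: "0 \<le> \<Sigma>" unfolding \<Sigma>_def
    using q_Suc by (intro sum_nonneg mult_nonneg_nonneg) (auto simp: less_imp_le)
  have WA: "W (q j) \<in> borel_measurable (\<A> s)" if "j \<le> N" "q j \<le> s" "s \<le> T" for j s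
    using bm q_mem[OF that(1)] that
    by (intro measurable_filtration[OF filt, of "q j" s]) (auto simp: brownian_motion_def adapted_upto_def)
  have subalg: "subalgebra M (\<A> s)" if "0 \<le> s" "s \<le> T" for s
    using filt that unfolding filtration_upto_def by auto
  have WM: "W (q j) \<in> borel_measurable M" if "j \<le> N" for j
    by (rule measurable_from_subalg[OF subalg[of t] WA[of j t]]) (use q_mem[OF that] that ut in auto)
  have SA: "step_integral W n3 p3 c3 \<in> borel_measurable (\<A> u)" "step_integral W n4 p4 c4 \<in> borel_measurable (\<A> u)"
    using step_integral_measurable[OF filt bm] 3(2) 4(2) ut by auto
  have SM: "step_integral W n1 p1 c1 \<in> borel_measurable M" "step_integral W n2 p2 c2 \<in> borel_measurable M"
    "step_integral W n3 p3 c3 \<in> borel_measurable M" "step_integral W n4 p4 c4 \<in> borel_measurable M"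
    using measurable_from_subalg[OF subalg[of t] step_integral_measurable[OF filt bm 1(2)]]
      measurable_from_subalg[OF subalg[of t] step_integral_measurable[OF filt bm 2(2)]]
      measurable_from_subalg[OF subalg[of u] SA(1)] measurable_from_subalg[OF subalg[of u] SA(2)] ut by auto
  show thesis
  proof (rule that[of "sqrt \<Sigma>" V G])
    show "sqrt \<beta> / 2 \<le> sqrt \<Sigma>"
    proof -
      have "(\<integral>\<^sup>+s\<in>{u<..<t}. ennreal ((a1 * k1 s + a2 * k2 s)\<^sup>2) \<partial>lborel)
        \<le> 2 * (\<integral>\<^sup>+s\<in>{u<..<t}. ennreal ((f s)\<^sup>2) \<partial>lborel)
        + ennreal (4 * a1\<^sup>2) * (\<integral>\<^sup>+s\<in>{0<..<t}. ennreal ((k1 s - step_fun n1 p1 c1 s)\<^sup>2) \<partial>lborel)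
        + ennreal (4 * a2\<^sup>2) * (\<integral>\<^sup>+s\<in>{0<..<t}. ennreal ((k2 s - step_fun n2 p2 c2 s)\<^sup>2) \<partial>lborel)"
        unfolding f_def by (rule nn_integral_mixed_le)
          (use wi[THEN has_wiener_integralD(2)] ut(1) in simp_all)
      with \<beta>(2) have "ennreal \<beta> \<le> 2 * (\<integral>\<^sup>+s\<in>{u<..<t}. ennreal ((f s)\<^sup>2) \<partial>lborel)
        + ennreal (4 * a1\<^sup>2) * (\<integral>\<^sup>+s\<in>{0<..<t}. ennreal ((k1 s - step_fun n1 p1 c1 s)\<^sup>2) \<partial>lborel)
        + ennreal (4 * a2\<^sup>2) * (\<integral>\<^sup>+s\<in>{0<..<t}. ennreal ((k2 s - step_fun n2 p2 c2 s)\<^sup>2) \<partial>lborel)"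
        by (rule order_trans)
      also have "\<dots> \<le> 2 * ennreal \<Sigma> + ennreal (4 * a1\<^sup>2) * ennreal \<gamma> + ennreal (4 * a2\<^sup>2) * ennreal \<gamma>"
      proof (rule add_mono[OF add_mono[OF mult_left_mono mult_left_mono[OF 1(3)]] mult_left_mono[OF 2(3)]])
        have "f s = f (q (Suc j))" if "j < N" "q j < s" "s \<le> q (Suc j)" for j s
          unfolding f_def step_fun_refine[OF 1(1) q sub(1) that] step_fun_refine[OF 2(1) q sub(2) that] ..
        from nn_integral_step_le[where f=f, OF q m(1) this]
        show "(\<integral>\<^sup>+s\<in>{u<..<t}. ennreal ((f s)\<^sup>2) \<partial>lborel) \<le> ennreal \<Sigma>"
          by (simp add: m qN \<Sigma>_def)
      qed auto
      also have "\<dots> = ennreal (2 * \<Sigma> + 4 * a1\<^sup>2 * \<gamma> + 4 * a2\<^sup>2 * \<gamma>)"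
        using \<Sigma>0 \<gamma>(1) by (simp add: ennreal_mult)
      finally have "\<beta> \<le> 2 * \<Sigma> + 4 * a1\<^sup>2 * \<gamma> + 4 * a2\<^sup>2 * \<gamma>"
        using \<Sigma>0 \<gamma>(1) by (subst (asm) ennreal_le_iff) auto
      \<comment> \<open>With the error terms at most \<open>\<beta> / 2\<close>, half of
        \<open>\<beta>\<close> is left below \<open>2 * \<Sigma>\<close>. Taking roots loses the
        factor 2 in the claim.\<close>
      then have "\<beta> \<le> 4 * \<Sigma>" using \<gamma>(2) by simp
      then have "sqrt \<beta> \<le> sqrt (4 * \<Sigma>)" by simp
      then show ?thesis by (simp add: real_sqrt_mult)
    qed
    show V: "V \<in> borel_measurable (\<A> u)"
    proof -
      have "D j \<in> borel_measurable (\<A> u)" if "j < m" for j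
      proof -
        have "q j \<le> u" "q (Suc j) \<le> u"
          using that m strict_mono_on_less_eq[OF q, of j m] strict_mono_on_less_eq[OF q, of "Suc j" m] by auto
        with that m ut show ?thesis unfolding D_def
          by (intro borel_measurable_scaleR borel_measurable_const borel_measurable_diff WA) auto
      qed
      with SA show ?thesis unfolding V_def
        by (intro borel_measurable_sum borel_measurable_scaleR borel_measurable_const
            borel_measurable_diff borel_measurable_add) auto
    qed
    show "G \<in> borel_measurable M" unfolding G_def D_def
      by (intro borel_measurable_sum borel_measurable_scaleR borel_measurable_const borel_measurable_diff WM) auto
    show "(LINT \<omega>|M. \<phi> (Y \<omega> + G \<omega>)) = (LINT \<omega>|M. smooth (sqrt \<Sigma>) \<phi> (Y \<omega>))"
      if Y: "Y \<in> borel_measurable (\<A> u)" and \<phi>: "unit_valued \<phi>" for Y \<phi>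
      unfolding G_def D_def \<Sigma>_def
    proof (rule brownian_chain[OF M filt bm, THEN conjunct2])
      show "0 \<le> q i \<and> q i \<le> T" if "i \<le> N" for i using q_mem[OF that] ut by auto
    qed (use q_Suc m Y \<phi> in auto)
    show "(\<integral>\<^sup>+\<omega>. ennreal (norm ((a1 *\<^sub>R Y1 \<omega> + a2 *\<^sub>R Y2 \<omega>) - (a1 *\<^sub>R Z1 \<omega> + a2 *\<^sub>R Z2 \<omega>) - (V \<omega> + G \<omega>))) \<partial>M) \<le> ennreal \<kappa>"
    proof -
      define E1 where "E1 \<omega> = Y1 \<omega> - step_integral W n1 p1 c1 \<omega>" for \<omega>
      define E2 where "E2 \<omega> = Y2 \<omega> - step_integral W n2 p2 c2 \<omega>" for \<omega>
      define E3 where "E3 \<omega> = Z1 \<omega> - step_integral W n3 p3 c3 \<omega>" for \<omega>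
      define E4 where "E4 \<omega> = Z2 \<omega> - step_integral W n4 p4 c4 \<omega>" for \<omega>
      have [measurable]: "E1 \<in> borel_measurable M" "E2 \<in> borel_measurable M"
        "E3 \<in> borel_measurable M" "E4 \<in> borel_measurable M"
        unfolding E1_def E2_def E3_def E4_def using wi[THEN has_wiener_integralD(1)] SM by measurable
      have sum_D: "(\<Sum>j<m. D j \<omega>) + G \<omega> = a1 *\<^sub>R step_integral W n1 p1 c1 \<omega> + a2 *\<^sub>R step_integral W n2 p2 c2 \<omega>" for \<omega>
      proof -
        have "(\<Sum>j<m. D j \<omega>) + G \<omega> = (\<Sum>j<N. D j \<omega>)"
          unfolding G_def lessThan_atLeast0 using m by (simp add: sum.atLeastLessThan_concat)
        also have "\<dots> = a1 *\<^sub>R step_integral W n1 p1 c1 \<omega> + a2 *\<^sub>R step_integral W n2 p2 c2 \<omega>"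
          unfolding step_integral_refine[OF 1(1) q sub(1)] step_integral_refine[OF 2(1) q sub(2)] D_def f_def
          by (simp add: scaleR_sum_right scaleR_left_distrib sum.distrib)
        finally show ?thesis .
      qed
      have eq: "(a1 *\<^sub>R Y1 \<omega> + a2 *\<^sub>R Y2 \<omega>) - (a1 *\<^sub>R Z1 \<omega> + a2 *\<^sub>R Z2 \<omega>) - (V \<omega> + G \<omega>)
        = (a1 *\<^sub>R E1 \<omega> + a2 *\<^sub>R E2 \<omega>) - (a1 *\<^sub>R E3 \<omega> + a2 *\<^sub>R E4 \<omega>)" for \<omega>
      proof -
        have "V \<omega> + G \<omega> = ((\<Sum>j<m. D j \<omega>) + G \<omega>)
          - (a1 *\<^sub>R step_integral W n3 p3 c3 \<omega> + a2 *\<^sub>R step_integral W n4 p4 c4 \<omega>)"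
          by (simp add: V_def)
        then show ?thesis
          unfolding sum_D by (simp add: E1_def E2_def E3_def E4_def scaleR_diff_right)
      qed
      have "(\<integral>\<^sup>+\<omega>. ennreal (norm ((a1 *\<^sub>R E1 \<omega> + a2 *\<^sub>R E2 \<omega>) - (a1 *\<^sub>R E3 \<omega> + a2 *\<^sub>R E4 \<omega>))) \<partial>M)
        \<le> (\<integral>\<^sup>+\<omega>. ennreal \<bar>a1\<bar> * ennreal (norm (E1 \<omega>)) + ennreal \<bar>a2\<bar> * ennreal (norm (E2 \<omega>))
          + ennreal \<bar>a1\<bar> * ennreal (norm (E3 \<omega>)) + ennreal \<bar>a2\<bar> * ennreal (norm (E4 \<omega>)) \<partial>M)"
      proof (rule nn_integral_mono)
        fix \<omega>
        have "norm ((a1 *\<^sub>R E1 \<omega> + a2 *\<^sub>R E2 \<omega>) - (a1 *\<^sub>R E3 \<omega> + a2 *\<^sub>R E4 \<omega>))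
          \<le> (norm (a1 *\<^sub>R E1 \<omega>) + norm (a2 *\<^sub>R E2 \<omega>)) + (norm (a1 *\<^sub>R E3 \<omega>) + norm (a2 *\<^sub>R E4 \<omega>))"
          by (intro order_trans[OF norm_triangle_ineq4] add_mono norm_triangle_ineq)
        then show "ennreal (norm ((a1 *\<^sub>R E1 \<omega> + a2 *\<^sub>R E2 \<omega>) - (a1 *\<^sub>R E3 \<omega> + a2 *\<^sub>R E4 \<omega>)))
          \<le> ennreal \<bar>a1\<bar> * ennreal (norm (E1 \<omega>)) + ennreal \<bar>a2\<bar> * ennreal (norm (E2 \<omega>))
          + ennreal \<bar>a1\<bar> * ennreal (norm (E3 \<omega>)) + ennreal \<bar>a2\<bar> * ennreal (norm (E4 \<omega>))"
          by (simp flip: ennreal_mult ennreal_plus add: ennreal_leI)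
      qed
      also have "\<dots> = ennreal \<bar>a1\<bar> * (\<integral>\<^sup>+\<omega>. ennreal (norm (E1 \<omega>)) \<partial>M) + ennreal \<bar>a2\<bar> * (\<integral>\<^sup>+\<omega>. ennreal (norm (E2 \<omega>)) \<partial>M)
          + ennreal \<bar>a1\<bar> * (\<integral>\<^sup>+\<omega>. ennreal (norm (E3 \<omega>)) \<partial>M) + ennreal \<bar>a2\<bar> * (\<integral>\<^sup>+\<omega>. ennreal (norm (E4 \<omega>)) \<partial>M)"
        by (simp add: nn_integral_add nn_integral_cmult)
      also have "\<dots> \<le> ennreal \<bar>a1\<bar> * ennreal \<eta> + ennreal \<bar>a2\<bar> * ennreal \<eta> + ennreal \<bar>a1\<bar> * ennreal \<eta> + ennreal \<bar>a2\<bar> * ennreal \<eta>"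
        using 1(4) 2(4) 3(4) 4(4) unfolding E1_def E2_def E3_def E4_def
        by (intro add_mono mult_left_mono) auto
      also have "\<dots> = ennreal (2 * (\<bar>a1\<bar> + \<bar>a2\<bar>) * \<eta>)"
        using \<eta>(1) by (simp flip: ennreal_mult ennreal_plus add: algebra_simps)
      also have "\<dots> \<le> ennreal \<kappa>" using \<eta>(2) by (rule ennreal_leI)
      finally show ?thesis unfolding eq .
    qed
  qed
qed

section \<open>Absolute continuity\<close>

text \<open>The exponent of \<open>\<delta>\<close> in \<open>\<epsilon>\<close> is the midpoint of
  1 and \<open>1 / h\<close>. With it \<open>\<delta> / \<epsilon> powr h\<close> is exactly of
  order \<open>\<delta> powr ((1 - h) / 2)\<close>, and \<open>\<epsilon> / \<delta>\<close> is no
  larger in order. The factor \<open>e\<close> keeps \<open>\<epsilon>\<close> inside the window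
  where the kernel bound holds.\<close>

lemma scale_bounds:
  fixes h e :: real and n :: nat
  assumes h: "0 < h" "h < 1" and e: "0 < e"
  defines "\<delta> \<equiv> (1/2)^n" and "r \<equiv> (1/2) powr ((1 - h) / 2)"
  defines "\<epsilon> \<equiv> e * \<delta> powr ((1 + 1 / h) / 2)"
  shows "0 < \<epsilon>" "\<epsilon> \<le> e" "\<epsilon> / \<delta> \<le> e * r^n" "\<delta> / \<epsilon> powr h = r^n / e powr h"
proof -
  have \<delta>: "0 < \<delta>" "\<delta> \<le> 1" by (auto simp: \<delta>_def power_le_one)
  have r: "r^n = \<delta> powr ((1 - h) / 2)"
    by (simp add: r_def \<delta>_def powr_power powr_powr mult.commute flip: powr_realpow)
  show "0 < \<epsilon>" using e \<delta> by (simp add: \<epsilon>_def)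
  have "\<delta> powr ((1 + 1 / h) / 2) \<le> 1" using \<delta> h by (intro powr_le1) auto
  then show "\<epsilon> \<le> e" using e by (simp add: \<epsilon>_def mult_left_le)
  have "\<epsilon> / \<delta> = e * \<delta> powr ((1 + 1 / h) / 2 - 1)"
    unfolding powr_diff \<epsilon>_def using \<delta> by simp
  also have "\<dots> \<le> e * \<delta> powr ((1 - h) / 2)"
  proof -
    \<comment> \<open>The comparison of exponents \<open>1 - h \<le> 1 / h - 1\<close> is
      \<open>(1 - h)\<^sup>2 \<ge> 0\<close> in disguise.\<close>
    have "1 + h * h \<ge> 2 * h" using sum_squares_bound[of 1 h] by (simp add: power2_eq_square)
    then have "(1 - h) / 2 \<le> (1 + 1 / h) / 2 - 1" using h by (simp add: field_simps)
    then show ?thesis using \<delta> e by (intro mult_left_mono powr_mono') auto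
  qed
  finally show "\<epsilon> / \<delta> \<le> e * r^n" by (simp add: r)
  have "\<epsilon> powr h = e powr h * \<delta> powr ((h + 1) / 2)"
  proof -
    have "(1 + 1 / h) / 2 * h = (h + 1) / 2" using h by (simp add: field_simps)
    then show ?thesis using e by (simp add: \<epsilon>_def powr_mult powr_powr)
  qed
  moreover have "\<delta> = \<delta> powr ((1 - h) / 2) * \<delta> powr ((h + 1) / 2)"
    using \<delta> by (simp flip: powr_add add: field_simps)
  ultimately show "\<delta> / \<epsilon> powr h = r^n / e powr h"
    using \<delta> e by (simp add: r field_simps)
qed

lemma norm_set_integral_diff_le:
  fixes g :: "real \<Rightarrow> 'a::euclidean_space"
  assumes int: "set_integrable lborel {0..T} g" and ut: "0 \<le> u" "u \<le> t" "t \<le> T"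
    and C: "\<And>s. s \<in> {0..T} \<Longrightarrow> norm (g s) \<le> C"
  shows "norm ((LINT s:{0..t}|lborel. g s) - (LINT s:{0..u}|lborel. g s)) \<le> C * (t - u)"
proof -
  have i: "set_integrable lborel {0..u} g" "set_integrable lborel {u<..t} g"
    by (rule set_integrable_subset[OF int]; use ut in auto)+
  have "{0..t} = {0..u} \<union> {u<..t}" using ut by auto
  then have "(LINT s:{0..t}|lborel. g s) = (LINT s:{0..u}|lborel. g s) + (LINT s:{u<..t}|lborel. g s)"
    using set_integral_Un[OF _ i] by (simp add: disjoint_iff)
  then have "norm ((LINT s:{0..t}|lborel. g s) - (LINT s:{0..u}|lborel. g s)) = norm (LINT s:{u<..t}|lborel. g s)"
    by simp
  also have "\<dots> \<le> (LINT s|lborel. norm (indicator {u<..t} s *\<^sub>R g s))"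
    unfolding set_lebesgue_integral_def by (rule integral_norm_bound)
  also have "\<dots> \<le> (LINT s|lborel. C * indicator {u<..t} s)"
  proof (rule integral_mono)
    show "integrable lborel (\<lambda>s. norm (indicator {u<..t} s *\<^sub>R g s))"
      using i(2) unfolding set_integrable_def by (rule integrable_norm)
    show "norm (indicator {u<..t} s *\<^sub>R g s) \<le> C * indicator {u<..t} s" for s
      using C[of s] ut by (auto split: split_indicator)
  qed (use ut in auto)
  also have "\<dots> = C * (t - u)" using ut by simp
  finally show ?thesis .
qed

text \<open>If \<open>X\<close> lies in a null set, \<open>f X\<close> lies in its linear image,
  which is again negligible. That image need not be Borel, so it is enclosed in a Borel null set
  before the law is evaluated.\<close>

lemma absolutely_continuous_distr_linear:
  fixes f :: "'a::euclidean_space \<Rightarrow> 'a"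
  assumes f: "linear f" "inj f" and [measurable]: "X \<in> borel_measurable M"
    and ac: "absolutely_continuous lborel (distr M borel (\<lambda>\<omega>. f (X \<omega>)))"
  shows "absolutely_continuous lborel (distr M borel X)"
  unfolding absolutely_continuous_def
proof
  have "f \<in> borel_measurable borel"
    using f(1) by (intro borel_measurable_continuous_onI linear_continuous_on linear_conv_bounded_linear[THEN iffD1])
  note [measurable] = this
  fix B :: "'a set" assume B: "B \<in> null_sets lborel"
  then have [measurable]: "B \<in> sets borel" by auto
  have "negligible B"
    using B by (simp add: negligible_iff_null_sets null_sets_completion_iff)
  then have "negligible (f ` B)"
    using f(1) by (intro negligible_differentiable_image_negligible linear_imp_differentiable_on) auto
  then obtain N where N: "N \<in> null_sets lborel" "f ` B \<subseteq> N"
    by (auto simp: negligible_iff_null_sets null_sets_completion_iff2)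
  from N(1) have [measurable]: "N \<in> sets borel" by auto
  have "emeasure (distr M borel X) B \<le> emeasure (distr M borel (\<lambda>\<omega>. f (X \<omega>))) N"
    using N(2) by (subst (1 2) emeasure_distr) (auto intro!: emeasure_mono)
  also have "\<dots> = 0"
    using ac N(1) by (auto simp: absolutely_continuous_def)
  finally show "B \<in> null_sets (distr M borel X)" by (auto simp: null_sets_def)
qed

text \<open>The estimate is made for the solution multiplied by the inverse matrix, whose noise is
  the bare mixture of \<open>B1\<close> and \<open>B2\<close>; its innovations are isotropic and
  thus of the form \<open>gauss\<close>. The smaller index comes first, so the opposite ordering is
  reached by exchanging the two summands.\<close>

lemma weak_solution_absolutely_continuous:
  fixes X :: "real \<Rightarrow> 'w \<Rightarrow> real ^ 'd" and A A' :: "real ^ 'd ^ 'd"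
  assumes H: "0 < H1" "H1 < H2" "H2 < 1" and a1: "a1 \<noteq> 0"
    and A': "A' ** A = mat 1"
    and bound: "bounded ((\<lambda>(s, x). b s x) ` ({0..T} \<times> UNIV))"
    and M: "prob_space M" and filt: "filtration_upto M T \<A>" and adX: "adapted_upto T \<A> X"
    and bm: "brownian_motion M T \<A> W" and fbm: "fbm_driven_by M T W H1 B1" "fbm_driven_by M T W H2 B2"
    and int: "AE \<omega> in M. set_integrable lborel {0..T} (\<lambda>s. b s (X s \<omega>))"
    and eq: "AE \<omega> in M. \<forall>t\<in>{0..T}.
        X t \<omega> = x0 + (LINT s:{0..t}|lborel. b s (X s \<omega>)) + A *v (a1 *\<^sub>R B1 t \<omega> + a2 *\<^sub>R B2 t \<omega>)"
    and t: "0 < t" "t \<le> T"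
  shows "absolutely_continuous lborel (distr M borel (\<lambda>\<omega>. A' *v X t \<omega>))"
proof -
  interpret prob_space M by fact
  obtain C where C: "0 < C" "\<And>s x. s \<in> {0..T} \<Longrightarrow> norm (b s x) \<le> C"
    using bound unfolding bounded_pos by force
  obtain K where K: "0 < K" "\<And>x. norm (A' *v x) \<le> norm x * K"
    using bounded_linear.pos_bounded[OF matrix_vector_mul_bounded_linear[of A']] by auto
  obtain c e where ce: "0 < c" "0 < e" "e < t"
    and ker: "\<And>s. t - e < s \<Longrightarrow> s < t \<Longrightarrow>
       c * (t - s) powr (H1 - 1/2) \<le> \<bar>a1 * fbm_kernel H1 t s + a2 * fbm_kernel H2 t s\<bar>"
    using mixed_kernel_lower_bound[OF H t(1) a1] by metis
  have h1: "H1 < 1" using H by simp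
  have XA: "X s \<in> borel_measurable (\<A> s)" if "0 \<le> s" "s \<le> T" for s
    using adX that unfolding adapted_upto_def by auto
  have subalg: "subalgebra M (\<A> s)" if "0 \<le> s" "s \<le> T" for s
    using filt that unfolding filtration_upto_def by auto
  have XM: "X s \<in> borel_measurable M" if "0 \<le> s" "s \<le> T" for s
    using measurable_from_subalg[OF subalg XA] that by blast
  have A'm: "(*v) A' \<in> borel_measurable borel"
    by (intro borel_measurable_continuous_onI matrix_vector_mult_linear_continuous_on)
  have A'X: "(\<lambda>\<omega>. A' *v X s \<omega>) \<in> borel_measurable F" if "X s \<in> borel_measurable F" for s F
    using measurable_compose[OF that A'm] .
  note [measurable] = A'X[OF XM[OF less_imp_le[OF t(1)] t(2)]]
  define d where "d = real DIM(real ^ 'd)"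
  define r where "r = (1/2) powr ((1 - H1) / 2)"
  \<comment> \<open>The two scales \<open>\<delta>\<close> and \<open>\<delta> / 2\<close>
    contribute \<open>3 / \<delta>\<close> times the L1 error
    \<open>(K * C + 1) * \<epsilon>\<close>. The other term is \<open>d\<close> times their sum
    \<open>3 * \<delta> / 2\<close>, divided by the lower bound
    \<open>c * \<epsilon> powr H1 / 4\<close> for \<open>\<sigma>\<close>, which gives the
    6.\<close>
  define Q where "Q = (2 * d + 1) * (3 * (K * C + 1) * e + d * 6 / (c * e powr H1))"
  have d0: "0 \<le> d" by (simp add: d_def)
  have Q0: "0 \<le> Q" unfolding Q_def using d0 ce K C by (intro mult_nonneg_nonneg add_nonneg_nonneg divide_nonneg_nonneg) auto
  show ?thesis
  proof (rule absolutely_continuous_if_smoothings_Cauchy[where r=r and C=Q and ?n0.0=0])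
    show "prob_space (distr M borel (\<lambda>\<omega>. A' *v X t \<omega>))" by (rule prob_space_distr) simp
    show "r < 1" unfolding r_def using h1 powr_less_mono2[of "(1 - H1) / 2" "1/2" 1] by simp
  next
    fix n and \<phi> :: "real ^ 'd \<Rightarrow> real" assume \<phi>: "unit_valued \<phi>"
    define \<delta> :: real where "\<delta> = (1/2)^n"
    define \<epsilon> where "\<epsilon> = e * \<delta> powr ((1 + 1 / H1) / 2)"
    note sb = scale_bounds[OF H(1) h1 ce(2), of n, folded \<delta>_def r_def, folded \<epsilon>_def]
    have \<delta>: "0 < \<delta>" by (simp add: \<delta>_def)
    define u where "u = t - \<epsilon>"
    have u: "0 \<le> u" "u < t" "u \<le> T" "t - u = \<epsilon>" "t - e \<le> u"
      using sb(1,2) ce t by (auto simp: u_def)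
    \<comment> \<open>The variance bound of \<open>nn_integral_power_lower_bound\<close> for the
      mixed kernel on \<open>{u<..<t}\<close>; its root is of order
      \<open>\<epsilon> powr H1\<close>.\<close>
    define \<beta> where "\<beta> = c\<^sup>2 * \<epsilon> powr (2 * H1) / 4"
    have \<beta>: "0 < \<beta>" using ce sb(1) by (simp add: \<beta>_def)
    have "\<epsilon> powr (2 * H1) = (\<epsilon> powr H1)\<^sup>2"
      by (simp add: power2_eq_square flip: powr_add)
    then have "\<beta> = (c * \<epsilon> powr H1 / 2)\<^sup>2" by (simp add: \<beta>_def power_divide power_mult_distrib)
    then have sqrt_\<beta>: "sqrt \<beta> = c * \<epsilon> powr H1 / 2" using ce by simp
    have \<beta>_le: "ennreal \<beta> \<le> (\<integral>\<^sup>+s\<in>{u<..<t}. ennreal ((a1 * fbm_kernel H1 t s + a2 * fbm_kernel H2 t s)\<^sup>2) \<partial>lborel)"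
      unfolding \<beta>_def u(4)[symmetric] using ker u ce H
      by (intro nn_integral_power_lower_bound) auto
    have wi: "has_wiener_integral M W t (fbm_kernel H1 t) (B1 t)" "has_wiener_integral M W t (fbm_kernel H2 t) (B2 t)"
      "has_wiener_integral M W u (fbm_kernel H1 u) (B1 u)" "has_wiener_integral M W u (fbm_kernel H2 u) (B2 u)"
      using fbm t u unfolding fbm_driven_by_def by auto
    \<comment> \<open>The accuracy of the noise approximation is free and is set to
      \<open>\<epsilon>\<close>, the order of the drift error.\<close>
    obtain \<sigma> V G where \<sigma>: "sqrt \<beta> / 2 \<le> \<sigma>" and V: "V \<in> borel_measurable (\<A> u)" and G: "G \<in> borel_measurable M"
      and err: "(\<integral>\<^sup>+\<omega>. ennreal (norm ((a1 *\<^sub>R B1 t \<omega> + a2 *\<^sub>R B2 t \<omega>) - (a1 *\<^sub>R B1 u \<omega> + a2 *\<^sub>R B2 u \<omega>) - (V \<omega> + G \<omega>))) \<partial>M) \<le> ennreal \<epsilon>"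
      and VG: "\<And>Y \<phi>. Y \<in> borel_measurable (\<A> u) \<Longrightarrow> unit_valued \<phi> \<Longrightarrow>
        (LINT \<omega>|M. \<phi> (Y \<omega> + G \<omega>)) = (LINT \<omega>|M. smooth \<sigma> \<phi> (Y \<omega>))"
    proof (rule mixed_increment_approx[OF M filt bm u(1,2) t(2) wi \<beta> \<beta>_le sb(1)], goal_cases)
      case prems: (1 \<sigma> V G)
      show ?case by (rule prems(1)[OF prems(2-5)]) (rule prems(6))
    qed
    have \<sigma>': "c * \<epsilon> powr H1 / 4 \<le> \<sigma>" "0 < \<sigma>"
      using \<sigma> \<beta> ce sb(1) by (auto simp: sqrt_\<beta> intro!: less_le_trans[OF _ \<sigma>])
    define Y where "Y \<omega> = A' *v X u \<omega> + V \<omega>" for \<omega>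
    define Z where "Z \<omega> = Y \<omega> + G \<omega>" for \<omega>
    have YA: "Y \<in> borel_measurable (\<A> u)"
      unfolding Y_def by (intro borel_measurable_add V A'X XA u)
    have YM: "Y \<in> borel_measurable M"
      by (rule measurable_from_subalg[OF subalg YA]) (use u in auto)
    have ZM: "Z \<in> borel_measurable M"
      unfolding Z_def using YM G by (rule borel_measurable_add)
    define R where "R \<omega> = (a1 *\<^sub>R B1 t \<omega> + a2 *\<^sub>R B2 t \<omega>) - (a1 *\<^sub>R B1 u \<omega> + a2 *\<^sub>R B2 u \<omega>) - (V \<omega> + G \<omega>)" for \<omega>
    have VM: "V \<in> borel_measurable M"
      by (rule measurable_from_subalg[OF subalg V]) (use u in auto)
    note [measurable] = VM G wi[THEN has_wiener_integralD(1)]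
    have [measurable]: "R \<in> borel_measurable M" unfolding R_def by measurable
    have "(\<integral>\<^sup>+\<omega>. ennreal (norm (A' *v X t \<omega> - Z \<omega>)) \<partial>M) \<le> (\<integral>\<^sup>+\<omega>. ennreal (K * C * \<epsilon>) + ennreal (norm (R \<omega>)) \<partial>M)"
    proof (rule nn_integral_mono_AE)
      show "AE \<omega> in M. ennreal (norm (A' *v X t \<omega> - Z \<omega>)) \<le> ennreal (K * C * \<epsilon>) + ennreal (norm (R \<omega>))"
        using int eq
      proof eventually_elim
        case (elim \<omega>)
        define J where "J s = (LINT s:{0..s}|lborel. b s (X s \<omega>))" for s
        have J: "norm (J t - J u) \<le> C * \<epsilon>"
          unfolding J_def u(4)[symmetric] using elim(1) u t C
          by (intro norm_set_integral_diff_le[where T=T]) auto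
        have "X t \<omega> - X u \<omega> = (J t - J u)
            + A *v ((a1 *\<^sub>R B1 t \<omega> + a2 *\<^sub>R B2 t \<omega>) - (a1 *\<^sub>R B1 u \<omega> + a2 *\<^sub>R B2 u \<omega>))"
          using elim(2)[rule_format, of t] elim(2)[rule_format, of u] u t
          by (simp add: J_def matrix_vector_mult_diff_distrib)
        then have "A' *v (X t \<omega> - X u \<omega>) = A' *v (J t - J u)
            + ((a1 *\<^sub>R B1 t \<omega> + a2 *\<^sub>R B2 t \<omega>) - (a1 *\<^sub>R B1 u \<omega> + a2 *\<^sub>R B2 u \<omega>))"
          by (simp only: matrix_vector_right_distrib matrix_vector_mul_assoc A' matrix_vector_mul_lid)
        then have "A' *v X t \<omega> - Z \<omega> = A' *v (J t - J u) + R \<omega>"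
          by (simp add: Z_def Y_def R_def algebra_simps)
        then have "norm (A' *v X t \<omega> - Z \<omega>) \<le> norm (A' *v (J t - J u)) + norm (R \<omega>)"
          by (simp add: norm_triangle_ineq)
        also have "norm (A' *v (J t - J u)) \<le> C * \<epsilon> * K"
          using K(1) J by (intro order_trans[OF K(2)] mult_right_mono) auto
        finally have "norm (A' *v X t \<omega> - Z \<omega>) \<le> K * C * \<epsilon> + norm (R \<omega>)"
          by (simp add: mult_ac)
        from ennreal_leI[OF this] show ?case
          using K C sb(1) by simp
      qed
    qed
    also have "\<dots> = ennreal (K * C * \<epsilon>) + (\<integral>\<^sup>+\<omega>. ennreal (norm (R \<omega>)) \<partial>M)"
      by (simp add: nn_integral_add emeasure_space_1)
    also have "\<dots> \<le> ennreal (K * C * \<epsilon>) + ennreal \<epsilon>"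
      using err unfolding R_def by (rule add_left_mono)
    also have "\<dots> = ennreal ((K * C + 1) * \<epsilon>)"
      using K C sb(1) by (simp flip: ennreal_plus add: algebra_simps)
    finally have XZ: "(\<integral>\<^sup>+\<omega>. ennreal (norm (A' *v X t \<omega> - Z \<omega>)) \<partial>M) \<le> ennreal ((K * C + 1) * \<epsilon>)" .
    have "\<bar>expectation (\<lambda>\<omega>. smooth \<delta> \<phi> (A' *v X t \<omega>)) - expectation (\<lambda>\<omega>. smooth (\<delta> / 2) \<phi> (A' *v X t \<omega>))\<bar>
      \<le> (2 * d + 1) * ((K * C + 1) * \<epsilon> / \<delta> + (K * C + 1) * \<epsilon> / (\<delta> / 2) + d * (\<delta> + \<delta> / 2) / \<sigma>)"
      unfolding d_def
    proof (rule smooth_expectation_diff_le[OF \<phi>])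
      show "expectation (\<lambda>\<omega>. \<psi> (Z \<omega>)) = expectation (\<lambda>\<omega>. smooth \<sigma> \<psi> (Y \<omega>))" if "unit_valued \<psi>" for \<psi>
        unfolding Z_def by (rule VG[OF YA that])
    qed (use \<delta> \<sigma>' K C sb(1) YM ZM XZ in auto)
    also have "\<dots> \<le> Q * r^n"
    proof -
      have "d * (\<delta> + \<delta> / 2) / \<sigma> \<le> d * (\<delta> + \<delta> / 2) / (c * \<epsilon> powr H1 / 4)"
        using \<sigma>' d0 \<delta> ce sb(1) by (intro divide_left_mono mult_nonneg_nonneg mult_pos_pos) auto
      also have "\<dots> = d * 6 / c * (\<delta> / \<epsilon> powr H1)" using ce sb(1) by (simp add: field_simps)
      also have "\<dots> = d * 6 / (c * e powr H1) * r^n" unfolding sb(4) by simp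
      finally have 1: "d * (\<delta> + \<delta> / 2) / \<sigma> \<le> d * 6 / (c * e powr H1) * r^n" .
      have "(K * C + 1) * \<epsilon> / \<delta> + (K * C + 1) * \<epsilon> / (\<delta> / 2) = 3 * (K * C + 1) * (\<epsilon> / \<delta>)"
        using \<delta> by (simp add: field_simps)
      also have "\<dots> \<le> 3 * (K * C + 1) * (e * r^n)"
        using K C by (intro mult_left_mono sb(3)) auto
      finally have "(K * C + 1) * \<epsilon> / \<delta> + (K * C + 1) * \<epsilon> / (\<delta> / 2) + d * (\<delta> + \<delta> / 2) / \<sigma>
        \<le> 3 * (K * C + 1) * (e * r^n) + d * 6 / (c * e powr H1) * r^n"
        using 1 by (rule add_mono)
      also have "\<dots> = (3 * (K * C + 1) * e + d * 6 / (c * e powr H1)) * r^n"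
        by (simp add: distrib_right)
      finally show ?thesis
        unfolding Q_def mult.assoc[of "2 * d + 1"] using d0 by (intro mult_left_mono) auto
    qed
    finally have *: "\<bar>expectation (\<lambda>\<omega>. smooth \<delta> \<phi> (A' *v X t \<omega>)) - expectation (\<lambda>\<omega>. smooth (\<delta> / 2) \<phi> (A' *v X t \<omega>))\<bar> \<le> Q * r^n" .
    have tr: "(LINT x|distr M borel (\<lambda>\<omega>. A' *v X t \<omega>). smooth s \<phi> x) = expectation (\<lambda>\<omega>. smooth s \<phi> (A' *v X t \<omega>))"
      if "0 \<le> s" for s
      by (rule integral_distr) (use unit_valuedD(1)[OF smooth_unit_valued[OF that \<phi>]] in auto)
    show "\<bar>(LINT x|distr M borel (\<lambda>\<omega>. A' *v X t \<omega>). smooth ((1/2)^n) \<phi> x)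
        - (LINT x|distr M borel (\<lambda>\<omega>. A' *v X t \<omega>). smooth ((1/2)^Suc n) \<phi> x)\<bar> \<le> Q * r^n"
      using * by (simp add: tr \<delta>_def)
  qed (use Q0 in \<open>auto simp: r_def\<close>)
qed

theorem theorem4p9:
  fixes T H1 H2 a1 a2 :: real
    and x0 :: "real ^ 'd"
    and A :: "real ^ 'd ^ 'd"
    and b :: "real \<Rightarrow> real ^ 'd \<Rightarrow> real ^ 'd"
    and M :: "'w measure"
    and \<A> :: "real \<Rightarrow> 'w measure"
    and B1 B2 X :: "real \<Rightarrow> 'w \<Rightarrow> real ^ 'd"
  assumes "0 < T"
    and "H1 \<in> {0<..<1}" and "H2 \<in> {0<..<1}" and "H1 \<noteq> H2"
    and "a1 \<noteq> 0" and "a2 \<noteq> 0"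
    and "invertible A"
    and "(\<lambda>(s, x). b s x) \<in> borel_measurable (restrict_space borel ({0..T} \<times> UNIV))"
    and "bounded ((\<lambda>(s, x). b s x) ` ({0..T} \<times> UNIV))"
    and "weak_solution M \<A> T x0 b A a1 a2 H1 H2 B1 B2 X"
  shows "\<forall>t\<in>{0<..T}. \<exists>f. distributed M lborel (X t) f"
proof
  fix t assume "t \<in> {0<..T}"
  then have t: "0 < t" "t \<le> T" by auto
  from assms(10) obtain W where ws: "prob_space M" "filtration_upto M T \<A>" "adapted_upto T \<A> X"
    "brownian_motion M T \<A> W" "fbm_driven_by M T W H1 B1" "fbm_driven_by M T W H2 B2"
    "AE \<omega> in M. set_integrable lborel {0..T} (\<lambda>s. b s (X s \<omega>))"
    and eq: "AE \<omega> in M. \<forall>t\<in>{0..T}.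
        X t \<omega> = x0 + (LINT s:{0..t}|lborel. b s (X s \<omega>)) + A *v (a1 *\<^sub>R B1 t \<omega> + a2 *\<^sub>R B2 t \<omega>)"
    unfolding weak_solution_def by blast
  obtain A' where A': "A ** A' = mat 1" "A' ** A = mat 1"
    using assms(7) unfolding invertible_def by blast
  have ac: "absolutely_continuous lborel (distr M borel (\<lambda>\<omega>. A' *v X t \<omega>))"
  \<comment> \<open>The kernel with the smaller index must come first; in the second case the noise
    terms are exchanged, which leaves the equation unchanged.\<close>
  proof (cases "H1 < H2")
    case True
    show ?thesis
      by (rule weak_solution_absolutely_continuous[OF _ True _ assms(5) A'(2) assms(9) ws eq t])
         (use assms(2,3) in auto)
  next
    case False
    then have "H2 < H1" using assms(4) by simp
    have eq': "AE \<omega> in M. \<forall>t\<in>{0..T}.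
        X t \<omega> = x0 + (LINT s:{0..t}|lborel. b s (X s \<omega>)) + A *v (a2 *\<^sub>R B2 t \<omega> + a1 *\<^sub>R B1 t \<omega>)"
      using eq by (simp add: add.commute)
    show ?thesis
      by (rule weak_solution_absolutely_continuous[OF _ \<open>H2 < H1\<close> _ assms(6) A'(2) assms(9) ws(1-4) ws(6,5,7) eq' t])
         (use assms(2,3) in auto)
  qed
  have inj: "inj ((*v) A')"
    by (rule inj_on_inverseI[where g="(*v) A"]) (simp add: matrix_vector_mul_assoc A')
  have X: "X t \<in> borel_measurable M"
    using ws(2,3) t measurable_from_subalg unfolding filtration_upto_def adapted_upto_def
    by (metis atLeastAtMost_iff less_imp_le)
  have "absolutely_continuous lborel (distr M borel (X t))"
    by (rule absolutely_continuous_distr_linear[OF matrix_vector_mul_linear inj X ac])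
  \<comment> \<open>Radon-Nikodym: the density exists because the law of \<open>X t\<close> is
    absolutely continuous and Lebesgue measure is sigma-finite.\<close>
  then obtain f where "f \<in> borel_measurable lborel" "density lborel f = distr M borel (X t)"
    using sigma_finite_measure.Radon_Nikodym[OF sigma_finite_lborel, of "distr M borel (X t)"] by auto
  then have "distributed M lborel (X t) f"
    using X by (auto simp: distributed_def cong: distr_cong)
  then show "\<exists>f. distributed M lborel (X t) f" by (rule exI[of _ f])
qed

end
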